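(* Let $q>1$ and $c$ be such that either $c=1$ or $(q,c)\in\{(2,2),(2,4),(3,3),(4,2)\}$. Let $C_i$ be a sequence of formally self-dual codes over an alphabet of size $q$ in which all Hamming weights are divisible by $c$, and suppose $n(C_i)\to\infty$ as $i\to\infty$. Then \[ \limsup_{i\to\infty}\frac{d(C_i)}{n(C_i)}\le \frac{q-1}{q}\bigl(1-(c+1)^{-1/c}\bigr). \]
   Context: $n(C)$ denotes the length of the code $C$ and $d(C)$ its minimum (Hamming) distance. A code $C$ of length $n$ over an alphabet of size $q$ is formally self-dual if $|C|=q^{n/2}$ and its Hamming weight enumerator $W_C(x,y)=\sum_{c\in C}x^{n-\mathrm{wt}(c)}y^{\mathrm{wt}(c)}$ is invariant under the MacWilliams transform, i.e. $W_C(x,y)=q^{-n/2}W_C(x+(q-1)y,\,x-y)$. *)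

theory Defs
  imports Complex_Main "HOL-Library.Extended_Real"
begin

text \<open>
  Words are lists over an alphabet \<open>A\<close>. No algebraic structure on \<open>A\<close> and no linearity of
  codes is assumed; the symbol \<open>z \<in> A\<close> plays the role of zero in the Hamming weight.
\<close>

definition words :: "'a set \<Rightarrow> nat \<Rightarrow> 'a list set" where
  "words A n = {w. set w \<subseteq> A \<and> length w = n}"

definition hamming_weight :: "'a \<Rightarrow> 'a list \<Rightarrow> nat" where
  "hamming_weight z w = card {i. i < length w \<and> w ! i \<noteq> z}"

definition hamming_dist :: "'a list \<Rightarrow> 'a list \<Rightarrow> nat" where
  "hamming_dist u v = card {i. i < length u \<and> u ! i \<noteq> v ! i}"

text \<open>
  Unspecified for codes with fewer than two words. A formally self-dual code over an alphabet
  with at least two symbols has fewer than two words only if its length is \<open>0\<close>.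
\<close>

definition min_dist :: "'a list set \<Rightarrow> nat" where
  "min_dist C = Min {hamming_dist u v | u v. u \<in> C \<and> v \<in> C \<and> u \<noteq> v}"

text \<open>
  The weight enumerator is given by its polynomial function on the reals; an identity for all
  real arguments is the same as an identity of polynomials in two variables.
\<close>

definition weight_enumerator :: "'a \<Rightarrow> nat \<Rightarrow> 'a list set \<Rightarrow> real \<Rightarrow> real \<Rightarrow> real" where
  "weight_enumerator z n C x y = (\<Sum>w\<in>C. x ^ (n - hamming_weight z w) * y ^ hamming_weight z w)"

text \<open>
  The size condition uses the real power since \<open>n\<close> may be odd when \<open>card A\<close> is a square.
\<close>

definition formally_self_dual :: "'a set \<Rightarrow> 'a \<Rightarrow> nat \<Rightarrow> 'a list set \<Rightarrow> bool" where
  "formally_self_dual A z n C \<longleftrightarrow>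
     C \<subseteq> words A n \<and>
     real (card C) = real (card A) powr (real n / 2) \<and>
     (\<forall>x y. weight_enumerator z n C x y =
        real (card A) powr (- (real n / 2)) *
        weight_enumerator z n C (x + (real (card A) - 1) * y) (x - y))"

end

theory Submission
  imports Defs "HOL-Computational_Algebra.Polynomial_FPS"
begin

text \<open>
  Write $w(u) = \sum_m a_{cm} u^m$, where $a_j$ is the number of words of weight $j$, and let
  $\sigma(s) = (1-s)/(1+(q-1)s)$, so that the MacWilliams identity relates $w(\sigma(s)^c)$ to
  $w(s^c)$. In each case there are polynomials $A$, $E$ in $u = y^c$ (the Gleason invariants) such
  that $E$ transforms like $w$, $A$ like $w$ up to a sign, and $B = u(1-u)^c$ like a power of $E$.
  Multiplying $w$ by $p = A (\theta E^r - B) E^e$ makes $w p \, y^{-k} (1-y^c)^{-k} dy$ with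
  $k = cK + 1$ a differential form invariant under $\sigma$ and $y \mapsto e^{2 \pi i/c} y$. All its
  poles are equivalent to $y = 0$, so its residue there vanishes; that is,
  $\sum_m a_{cm} b_{K-m} = 0$ where $b_J$ is the coefficient of $u^J$ in $p(u)(1-u)^{-k}$.

  For large $k$ the sign of $b_J$ is that of $p$ at the saddle point $U = J/(k-1+J)$. For $J = K$
  this is $u_0 = 1/(c+1)$, where $A < 0$ and $B/E^r$ takes the same value as at
  $u_1 = \sigma(u_0^{1/c})^c$, while $A > 0$ and $B/E^r$ increases on $[0,u_1]$. With
  $\theta$ just below the common value, $b_K > 0$, and $b_J > 0$ as soon as $U$ is a little
  below $u_1$. The weight $c(K-J)$ belonging to $U = u_1$ is asymptotically the claimed
  multiple of $n$, so a larger minimum distance would make the vanishing sum positive.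
\<close>

unbundle fps_syntax

section \<open>Change of variables for formal residues\<close>

text \<open>The residue of $h(v) v^{-n-1} dv$ at $0$ is unchanged by the substitution $v = V(x)$.\<close>

lemma fps_nth_change_of_variable:
  fixes h V U :: "'a::field_char_0 fps"
  assumes V: "V = fps_X * U" and U0: "U $ 0 \<noteq> 0"
  shows "((h oo V) * fps_deriv V * inverse U ^ Suc n) $ n = h $ n"
proof -
  have V0: "V $ 0 = 0" by (simp add: V)
  have UI: "U * inverse U = 1" using U0 by (simp add: inverse_mult_eq_1')
  have UIp: "U ^ i * inverse U ^ i = 1" for i
    by (metis UI power_mult_distrib power_one)
  have dV: "fps_deriv V = U + fps_X * fps_deriv U"
    by (simp add: V algebra_simps)
  \<comment> \<open>By linearity the content lies in monomials: v^(i-n-1) dv has residue 1 for i = n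
    and is exact otherwise.\<close>
  have mon: "(V ^ i * fps_deriv V * inverse U ^ Suc n) $ n = (if i = n then 1 else 0)" for i
  proof (cases "i \<le> n")
    case False
    have "V ^ i * fps_deriv V * inverse U ^ Suc n = fps_X ^ i * (U ^ i * fps_deriv V * inverse U ^ Suc n)"
      by (simp add: V power_mult_distrib mult_ac)
    then show ?thesis using False by (simp only: fps_X_power_mult_nth) simp
  next
    case True
    define r where "r = n - i"
    have n: "n = i + r" using True by (simp add: r_def)
    have "V ^ i * fps_deriv V * inverse U ^ Suc n
        = fps_X ^ i * ((U ^ i * inverse U ^ i) * fps_deriv V * inverse U ^ Suc r)"
      by (simp add: V n power_mult_distrib power_add mult_ac)
    also have "\<dots> = fps_X ^ i * (fps_deriv V * inverse U ^ Suc r)" by (simp add: UIp)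
    also have "\<dots> $ n = (fps_deriv V * inverse U ^ Suc r) $ r"
      by (simp add: fps_X_power_mult_nth n del: power_Suc)
    also have "fps_deriv V * inverse U ^ Suc r = inverse U ^ r * (U * inverse U) + fps_X * (fps_deriv U * inverse U ^ Suc r)"
      by (simp add: dV algebra_simps)
    also have "\<dots> = inverse U ^ r + fps_X * (fps_deriv U * inverse U ^ Suc r)" by (simp only: UI mult_1_right)
    also have "\<dots> $ r = (if r = 0 then 1 else 0)"
    proof (cases r)
      case 0 then show ?thesis by simp
    next
      case (Suc s)
      \<comment> \<open>A derivative has no residue: comparing the coefficients of X^s gives r times
        the desired sum, and r is invertible in characteristic 0.\<close>
      have "fps_deriv (inverse U ^ r) = - (of_nat r * (fps_deriv U * inverse U ^ Suc r))"
        unfolding Suc fps_deriv_power' fps_inverse_deriv[OF U0]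
        by (simp add: power2_eq_square mult_ac del: of_nat_Suc)
      then have "of_nat (Suc s) * (inverse U ^ r) $ Suc s = - (of_nat r * (fps_deriv U * inverse U ^ Suc r) $ s)"
        by (metis fps_deriv_nth Suc_eq_plus1 fps_neg_nth fps_mult_of_nat_nth(1))
      then have "(of_nat r :: 'a) * ((inverse U ^ r) $ r + (fps_deriv U * inverse U ^ Suc r) $ s) = 0"
        unfolding Suc by (simp add: algebra_simps del: power_Suc of_nat_Suc)
      then have "(inverse U ^ r) $ r + (fps_deriv U * inverse U ^ Suc r) $ s = 0"
        using Suc by (metis mult_eq_0_iff of_nat_eq_0_iff nat.distinct(1))
      then show ?thesis using Suc by (simp del: power_Suc)
    qed
    finally show ?thesis using True by (simp add: r_def)
  qed
  \<comment> \<open>Truncation suffices: V^(n+1) = X^(n+1) U^(n+1) pushes the contribution of the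
    tail \<open>g\<close> beyond coefficient n.\<close>
  define f where "f = (\<Sum>i\<le>n. fps_const (h $ i) * fps_X ^ i)"
  define g where "g = fps_shift (Suc n) h"
  have h: "h = f + fps_X ^ Suc n * g"
  proof (rule fps_ext)
    fix j
    show "h $ j = (f + fps_X ^ Suc n * g) $ j"
      by (cases "j \<le> n") (auto simp: f_def g_def fps_sum_nth fps_X_power_mult_nth fps_X_power_nth if_distrib cong: if_cong simp del: power_Suc)
  qed
  have "h oo V = (f oo V) + V ^ Suc n * (g oo V)"
    by (simp add: h fps_compose_add_distrib fps_compose_mult_distrib[OF V0] fps_X_power_compose[OF V0] V0 del: power_Suc)
  also have "f oo V = (\<Sum>i\<le>n. fps_const (h $ i) * V ^ i)"
    by (simp add: f_def fps_compose_sum_distrib fps_compose_mult_distrib[OF V0] fps_X_power_compose[OF V0] V0 del: power_Suc)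
  finally have "(h oo V) * fps_deriv V * inverse U ^ Suc n
     = (\<Sum>i\<le>n. fps_const (h $ i) * (V ^ i * fps_deriv V * inverse U ^ Suc n))
       + fps_X ^ Suc n * (U ^ Suc n * (g oo V) * fps_deriv V * inverse U ^ Suc n)"
    by (simp add: algebra_simps sum_distrib_left sum_distrib_right V power_mult_distrib del: power_Suc)
  also have "\<dots> $ n = (\<Sum>i\<le>n. h $ i * (if i = n then 1 else 0))"
    by (simp add: fps_sum_nth mon fps_X_power_mult_nth del: power_Suc)
  also have "\<dots> = h $ n" by (simp add: if_distrib cong: if_cong)
  finally show ?thesis .
qed

lemma fps_nth_compose_X_power_mult:
  fixes a :: "'a::comm_ring_1 fps"
  assumes "c > 0"
  shows "(a oo fps_X ^ c) $ (c * n) = a $ n"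
proof -
  have "(a oo fps_X ^ c) $ (c * n) = (\<Sum>i=0..c*n. if i = n then a $ i else 0)"
    unfolding fps_compose_nth
    by (rule sum.cong) (use assms in \<open>auto simp: power_mult[symmetric] fps_X_power_nth\<close>)
  also have "\<dots> = a $ n" using assms by (simp add: Suc_leI)
  finally show ?thesis .
qed

section \<open>Coefficients of powers of 1 - X\<close>

text \<open>The index is one less than the exponent: this is (1 - X)^(-k-1), so
  \<open>neg_power_fps (c * K)\<close> is the factor (1 - u)^(-k) of the differential form for k =
  cK + 1.\<close>

definition neg_power_fps :: "nat \<Rightarrow> real fps" where
  "neg_power_fps k = Abs_fps (\<lambda>j. of_nat ((k + j) choose k))"

lemma neg_power_fps: "neg_power_fps k = inverse ((1 - fps_X) ^ Suc k)"
  using one_minus_const_fps_X_neg_power'[of "Suc k" "1::real"]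
  by (simp add: neg_power_fps_def binomial_symmetric[of k])

lemma neg_power_fps_mult: "(1 - fps_X) ^ Suc k * neg_power_fps k = 1"
  by (simp add: neg_power_fps inverse_mult_eq_1' del: power_Suc)

lemma one_minus_X_power_nth: "((1 - fps_X :: real fps) ^ n) $ k = (- 1) ^ k * of_nat (n choose k)"
proof -
  have "(1 - fps_X :: real fps) ^ n = (1 + fps_X) ^ n oo (- fps_X)"
    by (simp add: fps_compose_power[symmetric] fps_compose_add_distrib)
  also have "\<dots> = (1 + fps_X) ^ n oo (fps_const (-1) * fps_X)"
    by (simp add: fps_const_neg[symmetric] del: fps_const_neg)
  finally show ?thesis
    by (simp add: fps_compose_linear fps_binomial_of_nat[symmetric] binomial_gbinomial)
qed

section \<open>Vanishing of the residue\<close>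

text \<open>The invariance identities hold away from the zero of 1 + (q - 1) s. As that zero is
  negative, agreement for s > 0 turns them into polynomial identities.\<close>

lemma poly_eqI_pos:
  fixes p r :: "real poly"
  assumes "\<And>s. s > 0 \<Longrightarrow> poly p s = poly r s"
  shows "p = r"
proof (rule ccontr)
  assume "p \<noteq> r"
  then have "finite {x. poly (p - r) x = 0}" by (intro poly_roots_finite) simp
  moreover have "{0<..<1} \<subseteq> {x. poly (p - r) x = 0}" using assms by auto
  ultimately have "finite {0<..<1::real}" by (rule rev_finite_subset)
  then show False by (simp add: infinite_Ioo)
qed

lemma poly_conv_sum_le:
  fixes p :: "'a::comm_semiring_1 poly"
  assumes "degree p \<le> M"
  shows "poly p x = (\<Sum>m\<le>M. coeff p m * x ^ m)"
proof -
  have "(\<Sum>m\<le>M. coeff p m * x ^ m) = (\<Sum>m\<le>degree p. coeff p m * x ^ m)"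
    using assms by (intro sum.mono_neutral_right) (auto simp: coeff_eq_0)
  then show ?thesis by (simp add: poly_altdef[of p])
qed

text \<open>The series is (1 - X)^(m-K-1), with negative exponent in the first case and a polynomial
  in the second. The split later separates the pole at u = 0 from the one at infinity.\<close>

lemma one_minus_X_power_mult_neg_power_nth:
  "((1 - fps_X) ^ m * neg_power_fps K) $ k =
     (if m \<le> K then of_nat ((k + K - m) choose k) else (-1) ^ k * of_nat ((m - Suc K) choose k))"
proof (cases "m \<le> K")
  case True
  let ?Y = "1 - fps_X :: real fps"
  have "?Y ^ Suc (K - m) * (?Y ^ m * neg_power_fps K) = ?Y ^ Suc (K - m) * neg_power_fps (K - m)"
    unfolding neg_power_fps_mult
    using True by (simp add: neg_power_fps_mult mult.assoc[symmetric] power_add[symmetric] Suc_diff_le del: power_Suc)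
  moreover have "?Y ^ Suc (K - m) \<noteq> 0"
    by (metis neg_power_fps_mult mult_zero_left zero_neq_one)
  ultimately have "?Y ^ m * neg_power_fps K = neg_power_fps (K - m)"
    by (metis mult_cancel_left)
  moreover have "K - m + k choose (K - m) = (k + K - m choose k)"
    using True binomial_symmetric[of "K - m" "K - m + k"] by (simp add: add.commute)
  ultimately show ?thesis using True by (simp add: neg_power_fps_def)
next
  case False
  then have "m = (m - Suc K) + Suc K" by simp
  then have "(1 - fps_X) ^ m * neg_power_fps K = (1 - fps_X) ^ (m - Suc K) * ((1 - fps_X) ^ Suc K * neg_power_fps K)"
    by (metis mult.assoc power_add)
  then show ?thesis using False by (simp add: neg_power_fps_mult one_minus_X_power_nth del: power_Suc)
qed

text \<open>
  The left-hand side is, up to sign, the residue of $N(u) u^{-K-1} (1-u)^{-k} du$ at $u = 1$ and the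
  coefficient on the right its residue at $u = 0$. The substitution $u = \sigma(s)^c$ takes $s = 0$
  to $u = 1$; the assumption \<open>inv\<close> turns the form into $N(s^c) s^{-k} (1-s^c)^{-k} ds$ up
  to a constant factor.
\<close>

lemma residue_transformation:
  fixes N :: "real poly" and q :: real and c K D L :: nat
  defines "L \<equiv> D * Suc (c * K) - 2"
  assumes c: "c > 0" and q: "q > 1" and D: "D \<ge> Suc c" and deg: "c * degree N \<le> L"
    and inv: "\<And>s. 1 + (q - 1) * s \<noteq> 0 \<Longrightarrow>
      poly N (((1 - s) / (1 + (q - 1) * s)) ^ c) * (1 + (q - 1) * s) ^ L = - (sqrt q ^ L * poly N (s ^ c))"
    and G: "\<And>s. (1 - s) * ((1 + (q - 1) * s) ^ c - (1 - s) ^ c) * (1 + (q - 1) * s) ^ (D - Suc c)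
      = sqrt q ^ D * (s * (1 - s ^ c))"
  shows "(\<Sum>m\<le>degree N. coeff N m * ((1 - fps_X) ^ m * neg_power_fps K) $ (c * K))
       = - real c * (fps_of_poly N * neg_power_fps (c * K)) $ K"
proof -
  define d where "d = degree N"
  define f where "f = coeff N"
  define k where "k = Suc (c * K)"
  define T where "T = fps_of_poly [:1, q - 1:]"
  define Y where "Y = fps_of_poly [:1, -1 :: real:]"
  have Y: "Y = 1 - fps_X" by (simp add: Y_def fps_of_poly_linear' fps_const_neg[symmetric] del: fps_const_neg)
  have T: "T = 1 + fps_const (q - 1) * fps_X" by (simp add: T_def fps_of_poly_linear')
  define \<sigma> where "\<sigma> = Y * inverse T"
  have T0: "T $ 0 = 1" by (simp add: T_def)
  have TI: "T * inverse T = 1" using T0 by (simp add: inverse_mult_eq_1')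
  have \<sigma>T: "\<sigma> * T = Y" by (simp add: \<sigma>_def mult.assoc TI mult.commute[of "inverse T"])
  have \<sigma>0: "\<sigma> $ 0 = 1" by (simp add: \<sigma>_def T0 Y)
  \<comment> \<open>The subtraction in \<open>L\<close> does not truncate. The 2 accounts for the
    factor T^2 that comes from the derivative of \<sigma>.\<close>
  have L2: "L + 2 = D * k"
  proof -
    have "2 \<le> D" using D c by simp
    also have "\<dots> \<le> D * k" by (simp add: k_def)
    finally show ?thesis by (simp add: L_def k_def)
  qed
  have cm: "c * m \<le> L" if "m \<le> d" for m
    using deg that unfolding d_def by (meson le_trans mult_le_mono2)
  define Ns where "Ns = (\<Sum>m\<le>d. fps_const (f m) * \<sigma> ^ (c * m))"
  define NX where "NX = (\<Sum>m\<le>d. fps_const (f m) * fps_X ^ (c * m))"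
  \<comment> \<open>This is \<open>inv\<close> with denominators cleared, first as a polynomial
    identity and then for power series.\<close>
  have 1: "Ns * T ^ L = - (fps_const (sqrt q ^ L) * NX)"
  proof -
    have "(\<Sum>m\<le>d. smult (f m) ([:1, -1:] ^ (c * m) * [:1, q - 1:] ^ (L - c * m)))
        = - smult (sqrt q ^ L) (\<Sum>m\<le>d. smult (f m) ([:0, 1:] ^ (c * m)))" (is "?l = ?r")
    proof (rule poly_eqI_pos)
      fix s :: real assume s: "s > 0"
      have nz: "1 + (q - 1) * s \<noteq> 0" using q s by (smt (verit) mult_pos_pos)
      have "poly ?l s = (\<Sum>m\<le>d. f m * ((1 - s) ^ (c * m) * (1 + (q - 1) * s) ^ (L - c * m)))"
        by (simp add: poly_sum mult.commute[of s])
      also have "\<dots> = (\<Sum>m\<le>d. f m * ((1 - s) / (1 + (q - 1) * s)) ^ (c * m) * (1 + (q - 1) * s) ^ L)"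
      proof (rule sum.cong)
        fix m assume "m \<in> {..d}"
        then have "(1 + (q - 1) * s) ^ L = (1 + (q - 1) * s) ^ (c * m) * (1 + (q - 1) * s) ^ (L - c * m)"
          using cm by (simp add: power_add[symmetric])
        then show "f m * ((1 - s) ^ (c * m) * (1 + (q - 1) * s) ^ (L - c * m)) =
           f m * ((1 - s) / (1 + (q - 1) * s)) ^ (c * m) * (1 + (q - 1) * s) ^ L"
          using nz by (simp add: power_divide)
      qed simp
      also have "\<dots> = poly N (((1 - s) / (1 + (q - 1) * s)) ^ c) * (1 + (q - 1) * s) ^ L"
        by (simp add: poly_altdef f_def d_def sum_distrib_right power_mult)
      also have "\<dots> = poly ?r s"
        by (simp add: inv[OF nz]) (simp add: poly_altdef[of N] poly_sum f_def d_def power_mult)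
      finally show "poly ?l s = poly ?r s" .
    qed
    then have "fps_of_poly ?l = fps_of_poly ?r" by simp
    then have "(\<Sum>m\<le>d. fps_const (f m) * (Y ^ (c * m) * T ^ (L - c * m))) = - (fps_const (sqrt q ^ L) * NX)"
      by (simp add: fps_of_poly_sum fps_of_poly_smult fps_of_poly_mult fps_of_poly_power fps_of_poly_uminus
          Y_def T_def NX_def)
    also have "(\<Sum>m\<le>d. fps_const (f m) * (Y ^ (c * m) * T ^ (L - c * m))) = Ns * T ^ L"
      unfolding Ns_def sum_distrib_right
    proof (rule sum.cong)
      fix m assume "m \<in> {..d}"
      then have "T ^ L = T ^ (c * m) * T ^ (L - c * m)"
        using cm by (simp add: power_add[symmetric])
      then show "fps_const (f m) * (Y ^ (c * m) * T ^ (L - c * m)) = fps_const (f m) * \<sigma> ^ (c * m) * T ^ L"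
        by (simp add: \<sigma>T[symmetric] power_mult_distrib mult_ac)
    qed simp
    finally show ?thesis by simp
  qed
  \<comment> \<open>V is u = \<sigma>(s)^c written in the local coordinate v = 1 - u at u = 1. By 2
    it has order exactly one in s, as the change of variables requires.\<close>
  define V where "V = 1 - \<sigma> ^ c"
  have V0: "V $ 0 = 0" by (simp add: V_def \<sigma>0 fps_power_zeroth)
  define U where "U = fps_shift 1 V"
  have V: "V = fps_X * U"
    by (rule fps_ext) (auto simp: U_def V0)
  have 2: "\<sigma> * U * T ^ D = fps_const (sqrt q ^ D) * (1 - fps_X ^ c)"
  proof -
    have "[:1, -1:] * ([:1, q - 1:] ^ c - [:1, -1:] ^ c) * [:1, q - 1:] ^ (D - Suc c)
        = smult (sqrt q ^ D) ([:0, 1:] * (1 - [:0, 1:] ^ c))" (is "?l = ?r")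
    proof (rule poly_eqI_pos)
      fix s :: real
      show "poly ?l s = poly ?r s" using G[of s] by (simp add: algebra_simps)
    qed
    then have "fps_of_poly ?l = fps_of_poly ?r" by simp
    then have "Y * (T ^ c - Y ^ c) * T ^ (D - Suc c) = fps_const (sqrt q ^ D) * (fps_X * (1 - fps_X ^ c))"
      by (simp only: fps_of_poly_mult fps_of_poly_smult fps_of_poly_power fps_of_poly_diff
          Y_def[symmetric] T_def[symmetric] fps_of_poly_fps_X fps_of_poly_1)
    also have "Y * (T ^ c - Y ^ c) * T ^ (D - Suc c) = \<sigma> * V * (T ^ Suc c * T ^ (D - Suc c))"
      by (simp add: \<sigma>T[symmetric] V_def algebra_simps power_mult_distrib)
    also have "T ^ Suc c * T ^ (D - Suc c) = T ^ D" using D by (simp only: power_add[symmetric]) simp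
    finally have "fps_X * (\<sigma> * U * T ^ D) = fps_X * (fps_const (sqrt q ^ D) * (1 - fps_X ^ c))"
      by (simp add: V mult_ac)
    then show ?thesis by (metis fps_X_neq_zero mult_cancel_left)
  qed
  have U0: "U $ 0 \<noteq> 0"
  proof
    assume "U $ 0 = 0"
    then have "(fps_const (sqrt q ^ D) * (1 - fps_X ^ c)) $ 0 = (0::real)" by (simp add: 2[symmetric])
    then show False using q c by simp
  qed
  have UI: "U ^ k * inverse U ^ k = 1"
    using U0 by (simp add: power_mult_distrib[symmetric] inverse_mult_eq_1')
  \<comment> \<open>N(u) u^(-K-1) in the coordinate v = 1 - u. Its coefficient of v^(cK) is, up to
    sign, the residue at u = 1.\<close>
  define h where "h = (\<Sum>m\<le>d. fps_const (f m) * (1 - fps_X) ^ m) * neg_power_fps K"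
  define W where "W = neg_power_fps K oo V"
  have YV: "(1 - fps_X) oo V = \<sigma> ^ c" using V0 by (simp add: fps_compose_sub_distrib V_def)
  have W: "\<sigma> ^ (c * Suc K) * W = 1"
  proof -
    have "((1 - fps_X) ^ Suc K * neg_power_fps K) oo V = (\<sigma> ^ c) ^ Suc K * W"
      by (simp only: fps_compose_mult_distrib[OF V0] fps_compose_power[OF V0, symmetric] YV W_def)
    then show ?thesis by (simp only: neg_power_fps_mult fps_compose_1 power_mult)
  qed
  have hV: "h oo V = Ns * W"
    by (simp add: h_def fps_compose_mult_distrib[OF V0] fps_compose_power[OF V0, symmetric] fps_compose_sum_distrib
        YV Ns_def W_def power_mult)
  have dT: "fps_deriv T = fps_const (q - 1)" and dY: "fps_deriv Y = -1" by (simp_all add: T Y)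
  have d\<sigma>: "fps_deriv \<sigma> * T ^ 2 = - fps_const q"
  proof -
    have "fps_deriv \<sigma> * T + \<sigma> * fps_deriv T = -1"
      using arg_cong[OF \<sigma>T, of fps_deriv] by (simp add: dY mult.commute add.commute)
    then have "fps_deriv \<sigma> * T * T + \<sigma> * T * fps_deriv T = - T"
      by (metis (no_types, opaque_lifting) distrib_right mult.assoc mult.commute mult_minus1)
    then have "fps_deriv \<sigma> * T ^ 2 = - T - Y * fps_const (q - 1)"
      by (simp add: dT \<sigma>T[symmetric] power2_eq_square algebra_simps)
    also have "\<dots> = - fps_const q"
      by (rule fps_ext) (simp add: T Y algebra_simps)
    finally show ?thesis .
  qed
  have dV: "fps_deriv V = - (of_nat c * \<sigma> ^ (c - 1) * fps_deriv \<sigma>)"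
    by (simp add: V_def fps_deriv_power' mult_ac)
  define Ex where "Ex = (h oo V) * fps_deriv V * inverse U ^ k"
  define G' where "G' = neg_power_fps (c * K) oo fps_X ^ c"
  define Z where "Z = - (of_nat c * (NX * G'))"
  have X0: "(fps_X ^ c :: real fps) $ 0 = 0" using c by simp
  have G': "(1 - fps_X ^ c) ^ k * G' = 1"
  proof -
    have "((1 - fps_X) ^ k * neg_power_fps (c * K)) oo fps_X ^ c = (1 - fps_X ^ c) ^ k * G'"
      using X0 by (simp only: fps_compose_mult_distrib[OF X0] fps_compose_power[OF X0, symmetric] G'_def
          fps_compose_sub_distrib fps_compose_1 fps_X_fps_compose_startby0)
    then show ?thesis by (simp only: k_def neg_power_fps_mult fps_compose_1)
  qed
  \<comment> \<open>F clears all denominators at once. By 2 it is a nonzero constant times (1 -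
    X^c)^k, so \<open>Ex = Z\<close> may be checked after multiplication by F.\<close>
  define F where "F = \<sigma> ^ k * U ^ k * T ^ (D * k)"
  have F: "F = fps_const (sqrt q ^ (D * k)) * (1 - fps_X ^ c) ^ k"
    unfolding F_def power_mult power_mult_distrib[symmetric] 2
    by (simp add: power_mult_distrib fps_const_power)
  have Fnz: "F \<noteq> 0"
  proof
    assume "F = 0"
    then have "F $ 0 = 0" by simp
    then show False using q c by (simp add: F fps_power_zeroth power_0_left)
  qed
  \<comment> \<open>F supplies \<sigma>^k and the derivative of V supplies \<sigma>^(c-1); together
    they are exactly the power that cancels \<open>W\<close>.\<close>
  have e: "k + (c - 1) = c * Suc K" using c by (simp add: k_def)
  have "Ex * F = - (of_nat c * Ns * (\<sigma> ^ (k + (c - 1)) * W) * (fps_deriv \<sigma> * T ^ 2) * T ^ L * (U ^ k * inverse U ^ k))"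
    unfolding Ex_def F_def hV dV L2[symmetric] power_add by (simp add: algebra_simps)
  also have "\<dots> = of_nat c * fps_const q * (Ns * T ^ L)"
    by (simp only: e W UI d\<sigma>) (simp add: algebra_simps fps_const_neg[symmetric] del: fps_const_neg)
  also have "\<dots> = - (of_nat c * (fps_const (q * sqrt q ^ L) * NX))"
    unfolding 1 by (simp add: algebra_simps fps_const_mult[symmetric] del: fps_const_mult)
  also have "q * sqrt q ^ L = sqrt q ^ (D * k)"
    using q by (simp add: L2[symmetric] power_add)
  also have "- (of_nat c * (fps_const (sqrt q ^ (D * k)) * NX)) = Z * F"
  proof -
    have "Z * F = - (of_nat c * (fps_const (sqrt q ^ (D * k)) * NX * ((1 - fps_X ^ c) ^ k * G')))"
      by (simp add: Z_def F algebra_simps)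
    then show ?thesis by (simp only: G' mult_1_right)
  qed
  finally have "Ex = Z" using Fnz by simp
  moreover have "Ex $ (c * K) = h $ (c * K)"
    unfolding Ex_def k_def by (rule fps_nth_change_of_variable[OF V U0])
  moreover have "h $ (c * K) = (\<Sum>m\<le>d. f m * ((1 - fps_X) ^ m * neg_power_fps K) $ (c * K))"
    by (simp add: h_def sum_distrib_right fps_sum_nth mult.assoc)
  moreover have "NX = fps_of_poly N oo fps_X ^ c"
  proof -
    have "N = (\<Sum>m\<le>d. smult (f m) ([:0, 1:] ^ m))"
      unfolding d_def f_def using poly_as_sum_of_monoms[of N] by (simp add: monom_altdef)
    then have "fps_of_poly N = (\<Sum>m\<le>d. fps_const (f m) * fps_X ^ m)"
      by (metis (no_types, lifting) fps_of_poly_sum fps_of_poly_smult fps_of_poly_power fps_of_poly_fps_X sum.cong)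
    then show ?thesis
      using X0 by (simp add: fps_compose_sum_distrib fps_compose_mult_distrib[OF X0] fps_compose_power[OF X0, symmetric] NX_def power_mult
          fps_X_power_compose)
  qed
  then have "Z $ (c * K) = - real c * (fps_of_poly N * neg_power_fps (c * K)) $ K"
    by (simp add: Z_def G'_def fps_compose_mult_distrib[OF X0, symmetric] fps_nth_compose_X_power_mult[OF c] fps_mult_of_nat_nth)
  ultimately show ?thesis by (simp add: d_def f_def)
qed

text \<open>For q = 2 one has \<sigma>(-\<sigma>(s)) = 1/s, and the inner sign is invisible in c-th
  powers for even c. Two applications of \<open>inv\<close>, whose minus signs cancel, therefore
  give N(1/u) u^M = N(u).\<close>

lemma palindromic_of_invariant:
  fixes N :: "real poly" and c L M :: nat
  assumes c: "c > 0" "even c" and L: "L = c * M" and deg: "degree N \<le> M" and m: "m \<le> M"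
    and inv: "\<And>s. 1 + s \<noteq> 0 \<Longrightarrow>
      poly N (((1 - s) / (1 + s)) ^ c) * (1 + s) ^ L = - (sqrt 2 ^ L * poly N (s ^ c))"
  shows "coeff N (M - m) = coeff N m"
proof -
  have inv': "poly N (1 / u) * u ^ M = poly N u" if "u > 0" for u
  proof -
    define s where "s = root c u"
    have s: "s > 0" "s ^ c = u" using that c by (simp_all add: s_def)
    define y where "y = (s - 1) / (1 + s)"
    have y1: "1 + y = 2 * s / (1 + s)" using s by (simp add: y_def field_simps)
    have nz: "1 + y \<noteq> 0" using s by (simp add: y1)
    have y2': "1 - y = 2 / (1 + s)" using s by (simp add: y_def field_simps)
    have y2: "(1 - y) / (1 + y) = 1 / s" unfolding y1 y2' using s by (simp add: divide_simps)
    have "y = - ((1 - s) / (1 + s))" by (simp add: y_def minus_divide_left)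
    then have y3: "y ^ c = ((1 - s) / (1 + s)) ^ c" using c by simp
    have "poly N ((1 / s) ^ c) * (2 * s / (1 + s)) ^ L = - (sqrt 2 ^ L * poly N (y ^ c))"
      using inv[OF nz] unfolding y2 unfolding y1 .
    then have "poly N ((1 / s) ^ c) * (2 * s / (1 + s)) ^ L * (1 + s) ^ L
       = - (sqrt 2 ^ L * (poly N (y ^ c) * (1 + s) ^ L))" by simp
    also have "\<dots> = sqrt 2 ^ L * sqrt 2 ^ L * poly N (s ^ c)"
      unfolding y3 using inv[of s] s by simp
    also have "sqrt 2 ^ L * sqrt 2 ^ L = (2::real) ^ L" by (simp add: power_mult_distrib[symmetric])
    also have "poly N ((1 / s) ^ c) * (2 * s / (1 + s)) ^ L * (1 + s) ^ L = 2 ^ L * (poly N ((1 / s) ^ c) * s ^ L)"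
      using s by (simp add: power_divide power_mult_distrib)
    finally show ?thesis using s(1) s(2)[symmetric] by (simp add: L power_mult power_divide)
  qed
  define N' where "N' = (\<Sum>m\<le>M. monom (coeff N (M - m)) m)"
  have "N' = N"
  proof (rule poly_eqI_pos)
    fix u :: real assume u: "u > 0"
    have "poly N' u = (\<Sum>m\<le>M. coeff N (M - m) * u ^ m)"
      by (simp add: N'_def poly_sum poly_monom)
    also have "\<dots> = (\<Sum>m\<le>M. coeff N m * u ^ (M - m))"
      using sum.nat_diff_reindex[of "\<lambda>m. coeff N m * u ^ (M - m)" "Suc M"] by (simp add: lessThan_Suc_atMost)
    also have "\<dots> = (\<Sum>m\<le>M. coeff N m * (1 / u) ^ m * u ^ M)"
      using u by (intro sum.cong) (auto simp: power_diff power_divide)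
    also have "\<dots> = poly N (1 / u) * u ^ M"
      by (simp add: poly_conv_sum_le[OF deg] sum_distrib_right)
    finally show "poly N' u = poly N u" using inv'[OF u] by simp
  qed
  moreover have "coeff N' m = coeff N (M - m)"
    using m by (simp add: N'_def coeff_sum)
  ultimately show ?thesis by simp
qed

text \<open>
  The residues at $u = 0$, $1$ and $\infty$ add up to $0$. If $D = c + 1$ there is no pole at infinity;
  if $D = c + 2$ the residue there equals the one at $0$ because $N$ is palindromic.
\<close>

lemma residue_vanishes:
  fixes N :: "real poly" and q :: real and c K D L :: nat
  defines "L \<equiv> D * Suc (c * K) - 2"
  assumes c: "c > 0" and q: "q > 1" and deg: "c * degree N \<le> L"
    and D: "D = c + 1 \<or> D = c + 2 \<and> even c \<and> q = 2"
    and inv: "\<And>s. 1 + (q - 1) * s \<noteq> 0 \<Longrightarrow>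
      poly N (((1 - s) / (1 + (q - 1) * s)) ^ c) * (1 + (q - 1) * s) ^ L = - (sqrt q ^ L * poly N (s ^ c))"
    and G: "\<And>s. (1 - s) * ((1 + (q - 1) * s) ^ c - (1 - s) ^ c) * (1 + (q - 1) * s) ^ (D - Suc c)
      = sqrt q ^ D * (s * (1 - s ^ c))"
  shows "(fps_of_poly N * neg_power_fps (c * K)) $ K = 0"
proof -
  define R where "R = (fps_of_poly N * neg_power_fps (c * K)) $ K"
  define f where "f = coeff N"
  \<comment> \<open>\<open>a\<close> carries the terms with a pole at u = 0, whose sum is R;
    \<open>b\<close> carries those with a residue at infinity.\<close>
  define a where "a m = (if m \<le> K then real ((c * K + K - m) choose (c * K)) else 0)" for m
  define b where "b m = (if m \<le> K then 0 else (-1) ^ (c * K) * real ((m - Suc K) choose (c * K)))" for m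
  have R: "R = (\<Sum>m\<le>M. f m * a m)" if M: "K \<le> M" for M
  proof -
    have "R = (\<Sum>m\<le>K. f m * a m)"
      unfolding R_def fps_mult_nth
      by (rule sum.cong) (auto simp: neg_power_fps_def f_def a_def)
    also have "\<dots> = (\<Sum>m\<le>M. f m * a m)"
      using M by (intro sum.mono_neutral_left) (auto simp: a_def)
    finally show ?thesis .
  qed
  have main: "(\<Sum>m\<le>M. f m * a m) + (\<Sum>m\<le>M. f m * b m) = - real c * R" if "degree N \<le> M" for M
  proof -
    have "(\<Sum>m\<le>M. f m * a m) + (\<Sum>m\<le>M. f m * b m) = (\<Sum>m\<le>M. f m * ((1 - fps_X) ^ m * neg_power_fps K) $ (c * K))"
      unfolding sum.distrib[symmetric] one_minus_X_power_mult_neg_power_nth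
      by (rule sum.cong) (auto simp: a_def b_def)
    also have "\<dots> = (\<Sum>m\<le>degree N. f m * ((1 - fps_X) ^ m * neg_power_fps K) $ (c * K))"
      using that by (intro sum.mono_neutral_right) (auto simp: f_def coeff_eq_0)
    also have "\<dots> = - real c * R"
      unfolding f_def R_def
      using residue_transformation[of c q D N K, folded L_def, OF c q _ deg inv G] D by auto
    finally show ?thesis .
  qed
  from D show ?thesis
  proof
    assume D1: "D = c + 1"
    \<comment> \<open>Here L = c (M + 1) - 1, so M bounds the degree of N. For K < m \<le> M the
      binomial in \<open>b m\<close> has upper index below cK and vanishes.\<close>
    define M where "M = c * K + K"
    have "c * degree N < c * (M + 1)" using deg c unfolding L_def D1 M_def by (simp add: algebra_simps)
    then have "degree N < M + 1" unfolding mult_less_cancel1 by blast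
    then have dM: "degree N \<le> M" by simp
    have "(\<Sum>m\<le>M. f m * b m) = 0"
      by (rule sum.neutral) (auto simp: b_def M_def)
    with main[OF dM] R[of M] have "R + real c * R = 0" by (simp add: M_def)
    then have "(1 + real c) * R = 0" by (simp add: algebra_simps)
    then show ?thesis by (simp add: R_def add_eq_0_iff)
  next
    assume D2: "D = c + 2 \<and> even c \<and> q = 2"
    \<comment> \<open>The reflection m -> M - m exchanges the two poles: M - m - K - 1 = cK + K - m,
      and (-1)^(cK) = 1 because c is even.\<close>
    define M where "M = Suc (c * K) + 2 * K"
    have L: "L = c * M" using D2 by (simp add: L_def M_def algebra_simps)
    then have dM: "degree N \<le> M" using deg c by simp
    have pal: "f (M - m) = f m" if "m \<le> M" for m
      unfolding f_def using palindromic_of_invariant[OF c _ L dM that] inv D2 by simp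
    have "(\<Sum>m\<le>M. f m * b m) = (\<Sum>m\<le>M. f (M - m) * b (M - m))"
      using sum.nat_diff_reindex[of "\<lambda>m. f m * b m" "Suc M"] by (simp add: lessThan_Suc_atMost)
    also have "\<dots> = (\<Sum>m\<le>M. f m * a m)"
    proof (rule sum.cong)
      fix m assume m: "m \<in> {..M}"
      have "b (M - m) = a m"
        using D2 by (auto simp: b_def a_def M_def Suc_diff_le add.commute)
      then show "f (M - m) * b (M - m) = f m * a m" using m pal by simp
    qed simp
    finally have "(\<Sum>m\<le>M. f m * b m) = (\<Sum>m\<le>M. f m * a m)" .
    moreover have "K \<le> M" by (simp add: M_def)
    ultimately have "2 * R + real c * R = 0" using main[OF dM] R[of M] by linarith
    then have "(2 + real c) * R = 0" by (simp add: algebra_simps)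
    then show ?thesis by (simp add: R_def add_eq_0_iff)
  qed
qed

section \<open>Coefficients of p(u) (1 - u)^(-\<kappa>-1) for large \<kappa>\<close>

text \<open>\<beta> i is the coefficient of u^(J-i) in (1 - u)^(-\<kappa>-1) relative to that of
  u^J. Consecutive ratios are (J - i)/(\<kappa> + J - i), within i/\<kappa> of x; since all factors
  lie in [0, 1], the errors simply add up.\<close>

lemma neg_power_coeff_ratio:
  fixes \<kappa> J i :: nat
  assumes \<kappa>: "\<kappa> > 0"
  defines "\<beta> \<equiv> \<lambda>i. if i \<le> J then real ((\<kappa> + (J - i)) choose \<kappa>) / real ((\<kappa> + J) choose \<kappa>) else 0"
    and "x \<equiv> real J / real (\<kappa> + J)"
  shows "0 \<le> \<beta> i \<and> \<beta> i \<le> 1 \<and> \<bar>\<beta> i - x ^ i\<bar> \<le> real (i^2) / real \<kappa>"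
proof (induction i)
  case 0
  have "(\<kappa> + J) choose \<kappa> > 0" by simp
  then show ?case by (simp add: \<beta>_def)
next
  case (Suc i)
  have x: "0 \<le> x" "x \<le> 1" using \<kappa> by (simp_all add: x_def)
  have sq: "real i / real \<kappa> + real (i^2) / real \<kappa> \<le> real ((Suc i)^2) / real \<kappa>"
    unfolding add_divide_distrib[symmetric] by (rule divide_right_mono) (simp_all add: power2_eq_square algebra_simps)
  show ?case
  proof (cases "i < J")
    case True
    define a where "a = J - i"
    define y where "y = real a / real (\<kappa> + a)"
    have "a * (\<kappa> + a choose \<kappa>) = (\<kappa> + a) * (\<kappa> + a - 1 choose \<kappa>)"
      using binomial_absorb_comp[of "\<kappa> + a" \<kappa>] by simp
    moreover have "\<kappa> + a - 1 = \<kappa> + (J - Suc i)" using True by (simp add: a_def)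
    ultimately have "real a * real (\<kappa> + a choose \<kappa>) = real (\<kappa> + a) * real (\<kappa> + (J - Suc i) choose \<kappa>)"
      by (metis of_nat_mult)
    then have "real (\<kappa> + (J - Suc i) choose \<kappa>) = real (\<kappa> + a choose \<kappa>) * y"
      using \<kappa> by (simp add: y_def field_simps)
    then have step: "\<beta> (Suc i) = \<beta> i * y"
      using True by (simp add: \<beta>_def a_def)
    have y: "0 \<le> y" "y \<le> 1" using \<kappa> by (simp_all add: y_def)
    have J: "real J = real a + real i" using True by (simp add: a_def)
    have "x - y = (real \<kappa> / (real \<kappa> + real J)) * (real i / (real \<kappa> + real a))"
      unfolding x_def y_def using \<kappa> by (simp add: J divide_simps) (simp add: algebra_simps)
    also have "\<dots> \<le> 1 * (real i / real \<kappa>)"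
      using \<kappa> by (intro mult_mono) (auto intro: divide_left_mono)
    finally have xy: "x - y \<le> real i / real \<kappa>" by simp
    have xy0: "y \<le> x" using True \<kappa> by (simp add: x_def y_def J divide_simps) (simp add: algebra_simps)
    have "\<beta> (Suc i) - x ^ Suc i = x * (\<beta> i - x ^ i) - \<beta> i * (x - y)"
      by (simp add: step algebra_simps)
    then have "\<bar>\<beta> (Suc i) - x ^ Suc i\<bar> \<le> \<bar>x * (\<beta> i - x ^ i)\<bar> + \<bar>\<beta> i * (x - y)\<bar>"
      by (metis abs_triangle_ineq4)
    also have "\<dots> \<le> 1 * (real (i^2) / real \<kappa>) + 1 * (real i / real \<kappa>)"
      unfolding abs_mult using Suc x xy xy0 by (intro add_mono mult_mono) auto
    finally show ?thesis
      using sq Suc y by (auto simp: step intro: mult_le_one)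
  next
    \<comment> \<open>Past index J the coefficient is 0, but then x \<le> J/\<kappa> \<le>
      i/\<kappa> is itself within the allowed error.\<close>
    case False
    then have "\<beta> (Suc i) = 0" by (simp add: \<beta>_def)
    moreover have "x ^ Suc i \<le> real i / real \<kappa>"
    proof -
      have "x ^ Suc i \<le> x" using x by (metis power_Suc mult_left_le power_le_one)
      also have "\<dots> \<le> real J / real \<kappa>" using \<kappa> unfolding x_def by (intro divide_left_mono) auto
      also have "\<dots> \<le> real i / real \<kappa>" using False by (intro divide_right_mono) auto
      finally show ?thesis .
    qed
    moreover have "real (i^2) / real \<kappa> \<ge> 0" by simp
    ultimately have "x ^ Suc i \<le> real ((Suc i)^2) / real \<kappa>" using sq by linarith
    then show ?thesis using x \<open>\<beta> (Suc i) = 0\<close> by (simp del: power_Suc of_nat_power)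
  qed
qed

text \<open>A saddle point estimate obtained monomial by monomial. The bound is uniform in J, so one
  threshold for \<kappa> serves all terms of the residue sum.\<close>

lemma neg_power_coeff_approx:
  fixes p :: "real poly"
  assumes \<kappa>: "\<kappa> > 0"
  shows "\<bar>(fps_of_poly p * neg_power_fps \<kappa>) $ J / real ((\<kappa> + J) choose \<kappa>) - poly p (real J / real (\<kappa> + J))\<bar>
     \<le> (\<Sum>i\<le>degree p. \<bar>coeff p i\<bar> * real (i^2)) / real \<kappa>"
proof -
  define \<beta> where "\<beta> i = (if i \<le> J then real ((\<kappa> + (J - i)) choose \<kappa>) / real ((\<kappa> + J) choose \<kappa>) else 0)" for i
  define x where "x = real J / real (\<kappa> + J)"
  note ratio = neg_power_coeff_ratio[OF \<kappa>, of _ J, folded \<beta>_def x_def]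
  define M where "M = max J (degree p)"
  have "(fps_of_poly p * neg_power_fps \<kappa>) $ J / real ((\<kappa> + J) choose \<kappa>) = (\<Sum>i\<le>J. coeff p i * \<beta> i)"
    unfolding fps_mult_nth sum_divide_distrib atLeast0AtMost
    by (rule sum.cong) (auto simp: neg_power_fps_def \<beta>_def)
  also have "\<dots> = (\<Sum>i\<le>M. coeff p i * \<beta> i)"
    by (rule sum.mono_neutral_left) (auto simp: M_def \<beta>_def)
  also have "\<dots> = (\<Sum>i\<le>degree p. coeff p i * \<beta> i)"
    by (rule sum.mono_neutral_right) (auto simp: M_def coeff_eq_0)
  finally have "(fps_of_poly p * neg_power_fps \<kappa>) $ J / real ((\<kappa> + J) choose \<kappa>) - poly p x
     = (\<Sum>i\<le>degree p. coeff p i * (\<beta> i - x ^ i))"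
    by (simp add: poly_altdef[of p] sum_subtractf algebra_simps)
  also have "\<bar>\<dots>\<bar> \<le> (\<Sum>i\<le>degree p. \<bar>coeff p i\<bar> * (real (i^2) / real \<kappa>))"
    by (rule order.trans[OF sum_abs], rule sum_mono) (simp only: abs_mult, use ratio in \<open>intro mult_left_mono; simp\<close>)
  finally show ?thesis by (simp add: x_def sum_divide_distrib)
qed

section \<open>The linear programming argument\<close>

text \<open>
  $D$ is the degree of the homogeneous form $y(x^c - y^c)$, with an additional factor $x$ if $q = 2$
  and $c > 1$, that vanishes on the orbit of $y = 0$; \<open>dA\<close> and \<open>dE\<close> are the
  degrees of $A$ and $E$ as forms in $x$, $y$.
\<close>

locale divisible_invariants =
  fixes q :: real and c D dA dE r :: nat and A E :: "real poly"
  assumes q: "q > 1" and c: "c > 0"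
    and D: "D = c + 1 \<or> D = c + 2 \<and> even c \<and> q = 2"
    and G: "\<And>s. (1 - s) * ((1 + (q - 1) * s) ^ c - (1 - s) ^ c) * (1 + (q - 1) * s) ^ (D - Suc c)
      = sqrt q ^ D * (s * (1 - s ^ c))"
    and E_inv: "\<And>s. 1 + (q - 1) * s \<noteq> 0 \<Longrightarrow>
      poly E (((1 - s) / (1 + (q - 1) * s)) ^ c) * (1 + (q - 1) * s) ^ dE = sqrt q ^ dE * poly E (s ^ c)"
    and A_inv: "\<And>s. 1 + (q - 1) * s \<noteq> 0 \<Longrightarrow>
      poly A (((1 - s) / (1 + (q - 1) * s)) ^ c) * (1 + (q - 1) * s) ^ dA = - (sqrt q ^ dA * poly A (s ^ c))"
    and deg_E: "c * degree E \<le> dE" and deg_A: "c * degree A \<le> dA"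
    and dE: "dE * r = c * D"
    and E_pos: "\<And>u. u \<ge> 0 \<Longrightarrow> poly E u > 0"
    and A_antimono: "\<And>u v. 0 \<le> u \<Longrightarrow> u \<le> v \<Longrightarrow> v \<le> 1 \<Longrightarrow> poly A v \<le> poly A u"
    and A_neg: "poly A (1 / (real c + 1)) < 0"
    and jacobian: "\<And>u. (1 - (real c + 1) * u) * poly E u - real r * u * (1 - u) * poly (pderiv E) u = poly A u"
begin

section \<open>The sign of A and the monotonicity of B / E^r\<close>

text \<open>The positive critical point of s (1 - s^c), where s^c = 1/(c + 1). The bound to be
  proved is (q - 1)(1 - y0)/q.\<close>

definition y0 :: real where "y0 = (real c + 1) powr (- (1 / real c))"
definition sg :: "real \<Rightarrow> real" where "sg s = (1 - s) / (1 + (q - 1) * s)"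
definition u1 :: real where "u1 = sg y0 ^ c"
definition B :: "real poly" where "B = [:0, 1:] * [:1, -1:] ^ c"
definition t :: "real \<Rightarrow> real" where "t u = poly B u / poly E u ^ r"

lemma y0_pos: "y0 > 0" by (simp add: y0_def)

lemma y0_power: "y0 ^ c = 1 / (real c + 1)"
proof -
  have "y0 ^ c = y0 powr real c" by (simp add: powr_realpow y0_pos)
  also have "\<dots> = (real c + 1) powr (- 1)" unfolding y0_def powr_powr using c by simp
  finally show ?thesis by (simp add: powr_minus_divide)
qed

lemma y0_less_1: "y0 < 1"
  unfolding y0_def using c powr_less_mono[of "- (1 / real c)" 0 "real c + 1"] by simp

lemma denom_pos: "s \<ge> 0 \<Longrightarrow> 1 + (q - 1) * s > 0"
  using q by (smt (verit) mult_nonneg_nonneg)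

lemma u1_bounds: "0 < u1" "u1 < 1"
proof -
  have "(q - 1) * y0 > 0" using q y0_pos by simp
  then have "0 < sg y0" "sg y0 < 1"
    using y0_pos y0_less_1 denom_pos[of y0] by (simp_all add: sg_def)
  then show "0 < u1" "u1 < 1" unfolding u1_def using c by (simp_all add: power_Suc_less_one power_less_one_iff)
qed

lemma D_ge: "D \<ge> Suc c" using D by auto

text \<open>\<open>G\<close> rewritten so that s (1 - s^c) transforms under \<sigma> with weight D.
  As B(s^c) is its c-th power, \<open>B_inv\<close> follows.\<close>

lemma G_sg:
  assumes "1 + (q - 1) * s \<noteq> 0"
  shows "sg s * (1 - sg s ^ c) * (1 + (q - 1) * s) ^ D = sqrt q ^ D * (s * (1 - s ^ c))"
proof -
  let ?T = "1 + (q - 1) * s"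
  have "D = 1 + c + (D - Suc c)" using D_ge by simp
  then have "?T ^ D = ?T * ?T ^ c * ?T ^ (D - Suc c)" by (metis power_add power_one_right)
  then have "sg s * (1 - sg s ^ c) * ?T ^ D = sg s * (1 - sg s ^ c) * (?T * ?T ^ c) * ?T ^ (D - Suc c)"
    by (simp only: mult.assoc)
  moreover have "sg s * (1 - sg s ^ c) * (?T * ?T ^ c) = (1 - s) * (?T ^ c - (1 - s) ^ c)"
  proof -
    have *: "sg s * ?T = 1 - s" using assms by (simp add: sg_def)
    have "sg s * (1 - sg s ^ c) * (?T * ?T ^ c) = (sg s * ?T) * (?T ^ c - (sg s * ?T) ^ c)"
      by (simp only: power_mult_distrib) (simp add: algebra_simps)
    then show ?thesis by (simp only: *)
  qed
  ultimately show ?thesis using G[of s] by simp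
qed

lemma B_power: "poly B (s ^ c) = (s * (1 - s ^ c)) ^ c"
  by (simp add: B_def power_mult_distrib)

lemma B_inv:
  assumes "1 + (q - 1) * s \<noteq> 0"
  shows "poly B (sg s ^ c) * (1 + (q - 1) * s) ^ (c * D) = sqrt q ^ (c * D) * poly B (s ^ c)"
  using arg_cong[OF G_sg[OF assms], of "\<lambda>x. x ^ c"]
  by (simp add: B_power power_mult_distrib power_mult[symmetric] mult.commute)

lemma E_power_inv:
  assumes "1 + (q - 1) * s \<noteq> 0"
  shows "poly (E ^ r) (sg s ^ c) * (1 + (q - 1) * s) ^ (c * D) = sqrt q ^ (c * D) * poly (E ^ r) (s ^ c)"
  using arg_cong[OF E_inv[OF assms], of "\<lambda>x. x ^ r"]
  by (simp add: sg_def power_mult_distrib power_mult[symmetric] dE)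

text \<open>B and E^r have the same weight, c D = dE r, so the transformation factors cancel in the
  quotient.\<close>

lemma t_inv:
  assumes "s \<ge> 0" "s \<le> 1"
  shows "t (sg s ^ c) = t (s ^ c)"
proof -
  let ?T = "(1 + (q - 1) * s) ^ (c * D)" and ?Q = "sqrt q ^ (c * D)"
  have nz: "1 + (q - 1) * s > 0" using denom_pos assms by simp
  then have T: "?T > 0" by simp
  have Q: "?Q > 0" using q by simp
  have "t (sg s ^ c) = (poly B (sg s ^ c) * ?T) / (poly (E ^ r) (sg s ^ c) * ?T)"
    unfolding t_def poly_power using T by (intro mult_divide_mult_cancel_right[symmetric]) linarith
  also have "\<dots> = (?Q * poly B (s ^ c)) / (?Q * poly (E ^ r) (s ^ c))"
    using nz by (simp only: B_inv E_power_inv)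
  also have "\<dots> = t (s ^ c)"
    unfolding t_def poly_power using Q by (intro mult_divide_mult_cancel_left) linarith
  finally show ?thesis .
qed

text \<open>A changes sign under \<sigma>, so its negative value at 1/(c + 1) becomes a positive one
  at u1; since A decreases on [0, 1], it is positive to the left of u1.\<close>

lemma A_pos:
  assumes "0 \<le> u" "u \<le> u1"
  shows "poly A u > 0"
proof -
  have nz: "1 + (q - 1) * y0 > 0" using denom_pos y0_pos by simp
  have "poly A u1 * (1 + (q - 1) * y0) ^ dA = - (sqrt q ^ dA * poly A (1 / (real c + 1)))"
    using A_inv[of y0] nz by (simp add: u1_def sg_def y0_power)
  also have "\<dots> > 0" using A_neg q by (simp add: mult_pos_neg)
  finally have "poly A u1 > 0" using nz by (simp add: zero_less_mult_iff)
  then show ?thesis using A_antimono[of u u1] assms u1_bounds by simp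
qed

lemma r_pos: "r > 0"
  using dE c D by (cases r) auto

text \<open>The assumption \<open>jacobian\<close> says that A is what remains of the numerator in
  the quotient rule after (1 - u)^(c-1) E^(r-1) is taken out.\<close>

lemma t_deriv:
  assumes "u \<ge> 0"
  shows "(t has_real_derivative (1 - u) ^ (c - 1) * poly A u / poly E u ^ Suc r) (at u)"
proof -
  have E: "poly E u > 0" using E_pos assms by simp
  obtain c' where c': "c = Suc c'" using c by (cases c) auto
  obtain r' where r': "r = Suc r'" using r_pos by (cases r) auto
  have t: "t = (\<lambda>u. u * (1 - u) ^ c / poly E u ^ r)" by (rule ext) (simp add: t_def B_def)
  have d1: "((\<lambda>u. u * (1 - u) ^ c) has_real_derivative ((1 - u) ^ c + u * (real c * (1 - u) ^ c' * (-1)))) (at u)"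
    by (auto intro!: derivative_eq_intros simp: c'[THEN arg_cong, of "\<lambda>n. n - 1", simplified])
  have d2: "((\<lambda>u. poly E u ^ r) has_real_derivative (real r * poly E u ^ r' * poly (pderiv E) u)) (at u)"
    by (auto intro!: derivative_eq_intros simp: r'[THEN arg_cong, of "\<lambda>n. n - 1", simplified])
  have "(t has_real_derivative
      ((((1 - u) ^ c + u * (real c * (1 - u) ^ c' * (-1))) * poly E u ^ r
        - u * (1 - u) ^ c * (real r * poly E u ^ r' * poly (pderiv E) u)) / (poly E u ^ r * poly E u ^ r))) (at u)"
    unfolding t using DERIV_divide[OF d1 d2] E by simp
  also have "(((1 - u) ^ c + u * (real c * (1 - u) ^ c' * (-1))) * poly E u ^ r
        - u * (1 - u) ^ c * (real r * poly E u ^ r' * poly (pderiv E) u))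
      = (1 - u) ^ c' * poly E u ^ r' * poly A u"
    unfolding jacobian[symmetric] by (simp add: c' r' algebra_simps)
  also have "\<dots> / (poly E u ^ r * poly E u ^ r) = (1 - u) ^ (c - 1) * poly A u / poly E u ^ Suc r"
    using E by (simp add: c' r' field_simps)
  finally show ?thesis .
qed

lemma t_mono:
  assumes "0 \<le> u" "u < v" "v \<le> u1"
  shows "t u < t v"
proof (rule DERIV_pos_imp_increasing[OF assms(2)])
  fix x assume x: "u \<le> x" "x \<le> v"
  have "(1 - x) ^ (c - 1) * poly A x / poly E x ^ Suc r > 0"
    using x assms A_pos[of x] E_pos[of x] u1_bounds by (intro divide_pos_pos mult_pos_pos zero_less_power) auto
  then show "\<exists>y. DERIV t x :> y \<and> 0 < y" using t_deriv[of x] x assms by auto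
qed

lemma t_y0: "t (1 / (real c + 1)) = t u1"
  using t_inv[of y0] y0_pos y0_less_1 by (simp add: u1_def y0_power)

text \<open>Differentiating \<open>G_sg\<close> at $y_0$, a critical point of $s(1 - s^c)$.\<close>

lemma u1_equation: "(1 - (real c + 1) * u1) * q = real D * (q - 1) * (1 - y0) * (1 - u1)"
proof -
  let ?T = "1 + (q - 1) * y0"
  have T: "?T > 0" using denom_pos y0_pos by simp
  define g where "g s = s - s ^ Suc c" for s :: real
  have dg: "(g has_real_derivative (1 - (real c + 1) * s ^ c)) (at s)" for s
    using DERIV_diff[OF DERIV_ident DERIV_pow[of "Suc c" s UNIV]] by (simp add: g_def[abs_def] add.commute)
  have dsg: "(sg has_real_derivative (- q / ?T ^ 2)) (at y0)"
    unfolding sg_def[abs_def] using T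
    by (auto intro!: derivative_eq_intros simp: power2_eq_square divide_simps) (simp add: algebra_simps)
  have "((\<lambda>s. g (sg s) * (1 + (q - 1) * s) ^ D) has_real_derivative
      (1 - (real c + 1) * sg y0 ^ c) * (- q / ?T ^ 2) * ?T ^ D
       + g (sg y0) * (real D * ?T ^ (D - 1) * (q - 1))) (at y0)"
    by (rule derivative_eq_intros DERIV_chain2[OF dg dsg] refl | simp)+
  moreover have "((\<lambda>s. sqrt q ^ D * g s) has_real_derivative sqrt q ^ D * (1 - (real c + 1) * y0 ^ c)) (at y0)"
    by (intro DERIV_cmult dg)
  then have "((\<lambda>s. g (sg s) * (1 + (q - 1) * s) ^ D) has_real_derivative sqrt q ^ D * (1 - (real c + 1) * y0 ^ c)) (at y0)"
  proof (rule has_field_derivative_transform_within_open[of _ _ _ "{0<..}"])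
    fix s :: real assume "s \<in> {0<..}"
    then have "1 + (q - 1) * s \<noteq> 0" using denom_pos[of s] by simp
    from G_sg[OF this] show "sqrt q ^ D * g s = g (sg s) * (1 + (q - 1) * s) ^ D"
      by (simp add: g_def algebra_simps)
  qed (use y0_pos in auto)
  ultimately have "(1 - (real c + 1) * u1) * (- q / ?T ^ 2) * ?T ^ D
       + g (sg y0) * (real D * ?T ^ (D - 1) * (q - 1)) = sqrt q ^ D * (1 - (real c + 1) * y0 ^ c)"
    unfolding u1_def by (rule DERIV_unique)
  then have eq: "(1 - (real c + 1) * u1) * (- q / ?T ^ 2) * ?T ^ D
       + g (sg y0) * (real D * ?T ^ (D - 1) * (q - 1)) = 0" by (simp add: y0_power)
  \<comment> \<open>D \<ge> c + 1 \<ge> 2, so T^(D-2) factors out in spite of the T^2 in the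
    denominator.\<close>
  obtain D' where D': "D = Suc (Suc D')" using D_ge c by (metis Suc_le_D Suc_le_mono gr0_conv_Suc)
  have aux: "X * (- q / \<tau> ^ 2) * \<tau> ^ D + y * (d * \<tau> ^ (D - 1) * (q - 1)) = \<tau> ^ D' * (y * \<tau> * d * (q - 1) - X * q)"
    if "\<tau> \<noteq> 0" for X \<tau> y d :: real
    using that by (simp add: D' power2_eq_square algebra_simps)
  have "?T ^ D' * (g (sg y0) * ?T * real D * (q - 1) - (1 - (real c + 1) * u1) * q) = 0"
    by (rule trans[OF aux[symmetric] eq]) (use T in linarith)
  then have "(1 - (real c + 1) * u1) * q = g (sg y0) * ?T * real D * (q - 1)" using T by simp
  also have "g (sg y0) * ?T = (1 - y0) * (1 - u1)"
  proof -
    have "g (sg y0) = sg y0 * (1 - u1)" by (simp add: g_def u1_def algebra_simps)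
    moreover have "sg y0 * ?T = 1 - y0" using T by (simp add: sg_def)
    ultimately show ?thesis by (simp add: mult.commute mult.left_commute)
  qed
  finally show ?thesis by (simp add: mult_ac)
qed

section \<open>The multiplier and the exclusion of a large gap\<close>

text \<open>A supplies the sign under \<sigma>, \<theta> E^r - B the sign change between u1 and 1/(c
  + 1). The power E^e is positive and only adjusts the weight, so that n plus the weight of the
  multiplier can equal D (cK + 1) - 2.\<close>

definition multiplier :: "real \<Rightarrow> nat \<Rightarrow> real poly" where
  "multiplier \<theta> e = A * (smult \<theta> (E ^ r) - B) * E ^ e"

lemma multiplier_inv:
  assumes "1 + (q - 1) * s \<noteq> 0"
  shows "poly (multiplier \<theta> e) (sg s ^ c) * (1 + (q - 1) * s) ^ (dA + c * D + e * dE) =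
     - (sqrt q ^ (dA + c * D + e * dE) * poly (multiplier \<theta> e) (s ^ c))"
proof -
  let ?T = "1 + (q - 1) * s"
  have 1: "poly (smult \<theta> (E ^ r) - B) (sg s ^ c) * ?T ^ (c * D) = sqrt q ^ (c * D) * poly (smult \<theta> (E ^ r) - B) (s ^ c)"
    using E_power_inv[OF assms] B_inv[OF assms] by (simp add: algebra_simps)
  have 2: "poly (E ^ e) (sg s ^ c) * ?T ^ (e * dE) = sqrt q ^ (e * dE) * poly (E ^ e) (s ^ c)"
    using arg_cong[OF E_inv[OF assms], of "\<lambda>x. x ^ e"]
    by (simp add: sg_def power_mult_distrib power_mult[symmetric] mult.commute)
  have "poly (multiplier \<theta> e) (sg s ^ c) * ?T ^ (dA + c * D + e * dE) =
     (poly A (sg s ^ c) * ?T ^ dA) * (poly (smult \<theta> (E ^ r) - B) (sg s ^ c) * ?T ^ (c * D)) * (poly (E ^ e) (sg s ^ c) * ?T ^ (e * dE))"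
    by (simp add: multiplier_def power_add mult_ac)
  also have "\<dots> = (- (sqrt q ^ dA * poly A (s ^ c))) * (sqrt q ^ (c * D) * poly (smult \<theta> (E ^ r) - B) (s ^ c)) * (sqrt q ^ (e * dE) * poly (E ^ e) (s ^ c))"
    unfolding 1 2 using A_inv[OF assms] by (simp add: sg_def)
  also have "\<dots> = - (sqrt q ^ (dA + c * D + e * dE) * poly (multiplier \<theta> e) (s ^ c))"
    by (simp add: multiplier_def power_add mult_ac)
  finally show ?thesis .
qed

lemma degree_multiplier: "c * degree (multiplier \<theta> e) \<le> dA + c * D + e * dE"
proof -
  have "degree B \<le> Suc c"
    unfolding B_def using degree_mult_le[of "[:0, 1::real:]" "[:1, -1:] ^ c"] degree_power_le[of "[:1, -1::real:]" c]
    by simp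
  then have "c * degree B \<le> c * D" using D_ge by simp
  moreover have "c * degree (smult \<theta> (E ^ r)) \<le> c * D"
  proof -
    have "c * degree (smult \<theta> (E ^ r)) \<le> c * (degree E * r)"
      using degree_smult_le[of \<theta> "E ^ r"] degree_power_le[of E r] by (meson le_trans mult_le_mono2)
    also have "\<dots> \<le> dE * r" using deg_E by (metis mult.assoc mult_le_mono1)
    finally show ?thesis by (simp add: dE)
  qed
  ultimately have 1: "c * degree (smult \<theta> (E ^ r) - B) \<le> c * D"
    using degree_diff_le_max[of "smult \<theta> (E ^ r)" B] c
    by (meson degree_diff_le mult_le_cancel1)
  have "c * degree (E ^ e) \<le> c * (degree E * e)" using degree_power_le[of E e] by (rule mult_le_mono2)
  also have "\<dots> \<le> dE * e" using deg_E by (metis mult.assoc mult_le_mono1)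
  finally have 2: "c * degree (E ^ e) \<le> e * dE" by (simp add: mult.commute)
  have "degree (multiplier \<theta> e) \<le> degree A + degree (smult \<theta> (E ^ r) - B) + degree (E ^ e)"
    unfolding multiplier_def by (meson add_le_mono1 degree_mult_le le_trans)
  then have "c * degree (multiplier \<theta> e) \<le> c * degree A + c * degree (smult \<theta> (E ^ r) - B) + c * degree (E ^ e)"
    by (metis add_mult_distrib2 mult_le_mono2)
  then show ?thesis using 1 2 deg_A by linarith
qed

lemma multiplier_pos:
  assumes "0 \<le> u" "u \<le> u1" "t u < \<theta>"
  shows "poly (multiplier \<theta> e) u > 0"
proof -
  have "poly B u < \<theta> * poly E u ^ r"
    using assms E_pos[of u] by (simp add: t_def pos_divide_less_eq)
  then show ?thesis using A_pos[of u] E_pos[of u] assms by (simp add: multiplier_def)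
qed

text \<open>By \<open>t_y0\<close> the quotient B / E^r at 1/(c + 1) exceeds \<theta>; since A is
  negative there, two negative factors meet.\<close>

lemma multiplier_pos_y0:
  assumes "\<theta> < t u1"
  shows "poly (multiplier \<theta> e) (1 / (real c + 1)) > 0"
proof -
  let ?u = "1 / (real c + 1)"
  have E: "poly E ?u > 0" by (rule E_pos) simp
  have "\<theta> < poly B ?u / poly E ?u ^ r" using assms t_y0 by (simp add: t_def)
  then have "\<theta> * poly E ?u ^ r - poly B ?u < 0" using E by (simp add: pos_less_divide_eq)
  then have "poly A ?u * (\<theta> * poly E ?u ^ r - poly B ?u) > 0" using A_neg by (intro mult_neg_neg)
  then show ?thesis using E by (simp add: multiplier_def)
qed

text \<open>If all weights strictly between 0 and \<delta> n were missing, every term of the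
  vanishing residue sum would be nonnegative and the term m = 0 positive. For fixed e the multiplier
  does not depend on n or K, which makes the threshold uniform.\<close>

lemma no_large_gap:
  assumes \<delta>: "\<delta> > (q - 1) / q * (1 - y0)"
  shows "\<exists>n0. \<forall>n\<ge>n0. \<forall>K w. D * Suc (c * K) = n + 2 + dA + c * D + e * dE \<longrightarrow>
     c * degree w \<le> n \<longrightarrow> (\<forall>m. coeff w m \<ge> 0) \<longrightarrow> coeff w 0 > 0 \<longrightarrow>
     (\<forall>s. 1 + (q - 1) * s \<noteq> 0 \<longrightarrow> poly w (sg s ^ c) * (1 + (q - 1) * s) ^ n = sqrt q ^ n * poly w (s ^ c)) \<longrightarrow>
     (\<exists>m>0. real (c * m) < \<delta> * real n \<and> coeff w m \<noteq> 0)"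
proof -
  \<comment> \<open>For J = K - m and U = J/(\<kappa> + J) this gives f U = c m/\<kappa>, so f
    translates saddle points into weights. As n is about D \<kappa>, the value f u1 corresponds to
    the claimed bound.\<close>
  define f where "f u = (1 - (real c + 1) * u) / (1 - u)" for u
  have f_u1: "f u1 = real D * ((q - 1) / q * (1 - y0))"
    using u1_equation u1_bounds q by (simp add: f_def field_simps)
  have f_anti: "f v \<le> f u" if "u \<le> v" "v < 1" for u v
  proof -
    have *: "f x = (real c + 1) - real c / (1 - x)" if "x < 1" for x
      using that by (simp add: f_def field_simps)
    have "real c / (1 - u) \<le> real c / (1 - v)" using that by (intro divide_left_mono) auto
    then show ?thesis using that * by simp
  qed
  have "f u1 < real D * \<delta>" using \<delta> D_ge unfolding f_u1 by (intro mult_strict_left_mono) auto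
  moreover have "(f \<longlongrightarrow> f u1) (at_left u1)"
    unfolding f_def using u1_bounds by (intro tendsto_intros) auto
  ultimately have "eventually (\<lambda>u. f u < real D * \<delta>) (at_left u1)"
    by (simp add: order_tendsto_iff)
  moreover have "eventually (\<lambda>u. u \<in> {0<..<u1}) (at_left u1)"
    using u1_bounds by (intro eventually_at_left_real)
  ultimately have "eventually (\<lambda>u. f u < real D * \<delta> \<and> u \<in> {0<..<u1}) (at_left u1)"
    by eventually_elim simp
  then obtain ud where ud: "f ud < real D * \<delta>" "0 < ud" "ud < u1"
    using eventually_happens[of _ "at_left u1"] by (auto simp: trivial_limit_at_left_real)
  \<comment> \<open>Any value strictly between t ud and t u1 makes p positive on [0, ud] and at 1/(c
    + 1).\<close>
  define \<theta> where "\<theta> = (t ud + t u1) / 2"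
  have "t ud < t u1" using t_mono ud by simp
  then have \<theta>: "t ud < \<theta>" "\<theta> < t u1" by (simp_all add: \<theta>_def)
  define p where "p = multiplier \<theta> e"
  have pos: "poly p u > 0" if "u \<in> {0..ud}" for u
  proof -
    have "t u \<le> t ud" using that ud t_mono[of u ud] by (cases "u = ud") auto
    then show ?thesis unfolding p_def using that ud \<theta> by (intro multiplier_pos) auto
  qed
  have "\<exists>x\<in>{0..ud}. \<forall>y\<in>{0..ud}. poly p x \<le> poly p y"
    using ud by (intro continuous_attains_inf) (auto intro: continuous_intros)
  then obtain x where x: "x \<in> {0..ud}" "\<And>y. y \<in> {0..ud} \<Longrightarrow> poly p x \<le> poly p y" by auto
  define \<epsilon> where "\<epsilon> = min (poly p x) (poly p (1 / (real c + 1)))"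
  have \<epsilon>: "\<epsilon> > 0" using pos[OF x(1)] multiplier_pos_y0[OF \<theta>(2)] by (simp add: \<epsilon>_def p_def)
  define S where "S = (\<Sum>i\<le>degree p. \<bar>coeff p i\<bar> * real (i^2))"
  have S0: "S \<ge> 0" unfolding S_def by (intro sum_nonneg) auto
  define Ce where "Ce = real (2 + dA + c * D + e * dE)"
  define \<eta> where "\<eta> = real D * \<delta> - f ud"
  have \<eta>: "\<eta> > 0" using ud by (simp add: \<eta>_def)
  \<comment> \<open>\<kappa> > S/\<epsilon> makes the approximation error smaller than \<epsilon>,
    the lower bound of p at the saddle points used. \<kappa> > |\<delta>| Ce/\<eta> absorbs the
    bounded difference between n and D \<kappa>. Since n < D (\<kappa> + 1), the choice of
    \<open>n0\<close> forces \<kappa> > k0.\<close>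
  define k0 where "k0 = S / \<epsilon> + \<bar>\<delta>\<bar> * Ce / \<eta> + 1"
  define n0 where "n0 = nat \<lceil>real D * (k0 + 1)\<rceil>"
  show ?thesis
  proof (rule exI[of _ n0], intro allI impI)
    fix n K w
    assume n: "n0 \<le> n" and deg: "D * Suc (c * K) = n + 2 + dA + c * D + e * dE"
      and dw: "c * degree w \<le> n" and w: "\<forall>m. coeff w m \<ge> 0" and w0: "coeff w 0 > 0"
      and winv: "\<forall>s. 1 + (q - 1) * s \<noteq> 0 \<longrightarrow> poly w (sg s ^ c) * (1 + (q - 1) * s) ^ n = sqrt q ^ n * poly w (s ^ c)"
    define \<kappa> where "\<kappa> = c * K"
    have D0: "real D > 0" using D_ge by simp
    have \<kappa>: "real \<kappa> > k0"
    proof -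
      have "real D * (k0 + 1) \<le> real n" using n unfolding n0_def by linarith
      also have "real n < real D * (real \<kappa> + 1)"
      proof -
        have "n < D * Suc \<kappa>" using deg unfolding \<kappa>_def by linarith
        then have "real n < real (D * Suc \<kappa>)" by (rule of_nat_less_iff[THEN iffD2])
        then show ?thesis by (simp add: algebra_simps)
      qed
      finally show ?thesis using D0 by simp
    qed
    have Ce0: "Ce \<ge> 0" by (simp add: Ce_def)
    have "\<bar>\<delta>\<bar> * Ce / \<eta> \<ge> 0" "S / \<epsilon> \<ge> 0" using Ce0 \<eta> S0 \<epsilon> by simp_all
    then have \<kappa>0: "\<kappa> > 0" and \<kappa>S: "S / \<epsilon> < real \<kappa>" and \<kappa>\<eta>: "\<bar>\<delta>\<bar> * Ce / \<eta> < real \<kappa>"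
      using \<kappa> unfolding k0_def by linarith+
    have S\<epsilon>: "S / real \<kappa> < \<epsilon>" using \<kappa>S \<kappa>0 \<epsilon> by (simp add: field_simps)
    have K0: "K > 0" using \<kappa>0 by (simp add: \<kappa>_def)
    define b where "b J = (fps_of_poly p * neg_power_fps \<kappa>) $ J" for J
    have b_pos: "b J > 0" if "poly p (real J / real (\<kappa> + J)) \<ge> \<epsilon>" for J
    proof -
      have "b J / real ((\<kappa> + J) choose \<kappa>) > 0"
        using neg_power_coeff_approx[OF \<kappa>0, of p J] that S\<epsilon> unfolding b_def S_def[symmetric] by linarith
      then show ?thesis by (simp add: zero_less_divide_iff)
    qed
    show "\<exists>m>0. real (c * m) < \<delta> * real n \<and> coeff w m \<noteq> 0"
    proof (rule ccontr)
      assume "\<not> ?thesis"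
      then have gap: "coeff w m = 0" if "m > 0" "real (c * m) < \<delta> * real n" for m using that by blast
      define N where "N = w * p"
      define L where "L = D * Suc (c * K) - 2"
      have L: "L = n + (dA + c * D + e * dE)" using deg by (simp add: L_def)
      have "degree N \<le> degree w + degree p" unfolding N_def by (rule degree_mult_le)
      then have "c * degree N \<le> c * degree w + c * degree p" by (metis add_mult_distrib2 mult_le_mono2)
      then have dN: "c * degree N \<le> L"
        using dw degree_multiplier[of \<theta> e] unfolding p_def L by linarith
      have Ninv: "poly N (((1 - s) / (1 + (q - 1) * s)) ^ c) * (1 + (q - 1) * s) ^ L = - (sqrt q ^ L * poly N (s ^ c))"
        if s: "1 + (q - 1) * s \<noteq> 0" for s
      proof -
        have "poly N (sg s ^ c) * (1 + (q - 1) * s) ^ L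
            = (poly w (sg s ^ c) * (1 + (q - 1) * s) ^ n)
              * (poly p (sg s ^ c) * (1 + (q - 1) * s) ^ (dA + c * D + e * dE))"
          unfolding N_def L power_add[of _ n] by simp
        also have "\<dots> = - (sqrt q ^ L * poly N (s ^ c))"
          unfolding p_def multiplier_inv[OF s] using winv s
          by (simp add: L power_add[of _ n] N_def p_def)
        finally show ?thesis by (simp add: sg_def)
      qed
      have "(fps_of_poly N * neg_power_fps (c * K)) $ K = 0"
        by (rule residue_vanishes[OF c q dN[unfolded L_def] D Ninv[unfolded L_def] G])
      moreover have "(fps_of_poly N * neg_power_fps (c * K)) $ K = (\<Sum>m\<le>K. coeff w m * b (K - m))"
        by (simp add: N_def fps_of_poly_mult mult.assoc \<kappa>_def[symmetric] fps_mult_nth[of "fps_of_poly w"] b_def atLeast0AtMost)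
      ultimately have sum0: "(\<Sum>m\<le>K. coeff w m * b (K - m)) = 0" by simp
      \<comment> \<open>For J = K and \<kappa> = cK the saddle point is exactly 1/(c + 1).\<close>
      have "b K > 0"
      proof (rule b_pos)
        have "real (\<kappa> + K) = real K * (real c + 1)" by (simp add: \<kappa>_def algebra_simps)
        then have "real K / real (\<kappa> + K) = 1 / (real c + 1)" using K0 by simp
        then show "\<epsilon> \<le> poly p (real K / real (\<kappa> + K))" by (simp add: \<epsilon>_def)
      qed
      then have "coeff w 0 * b (K - 0) > 0" using w0 by simp
      moreover have "coeff w m * b (K - m) \<ge> 0" if "m \<in> {..K}" for m
      proof (cases "m = 0 \<or> real (c * m) < \<delta> * real n")
        case True
        then show ?thesis using gap[of m] \<open>coeff w 0 * b (K - 0) > 0\<close> by (cases "m = 0") auto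
      next
        \<comment> \<open>A weight of at least \<delta> n gives f U > f ud for large \<kappa>. As f
          is antitone, U < ud, where p is at least \<epsilon>.\<close>
        case False
        define J where "J = K - m"
        define U where "U = real J / real (\<kappa> + J)"
        have J: "real J = real K - real m" using that by (simp add: J_def)
        have U: "0 \<le> U" "U < 1" using \<kappa>0 by (simp_all add: U_def)
        have "1 - U = real \<kappa> / real (\<kappa> + J)" using \<kappa>0 by (simp add: U_def field_simps)
        moreover have "1 - (real c + 1) * U = (real \<kappa> - real c * real J) / real (\<kappa> + J)"
          using \<kappa>0 by (simp add: U_def field_simps)
        ultimately have "f U = (real \<kappa> - real c * real J) / real \<kappa>" using \<kappa>0 by (simp add: f_def)
        also have "real \<kappa> - real c * real J = real (c * m)" by (simp add: \<kappa>_def J algebra_simps)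
        finally have fU: "f U = real (c * m) / real \<kappa>" .
        have "real n \<ge> real D * real \<kappa> - Ce"
          using arg_cong[OF deg, of real] D0 unfolding Ce_def \<kappa>_def by (simp add: algebra_simps)
        moreover have "\<delta> \<ge> 0"
        proof -
          have "(q - 1) / q * (1 - y0) \<ge> 0" using q y0_less_1 by simp
          then show ?thesis using \<delta> by linarith
        qed
        ultimately have "\<delta> * (real D * real \<kappa> - Ce) \<le> \<delta> * real n" by (intro mult_left_mono)
        also have "\<dots> \<le> real (c * m)" using False by simp
        also have "\<dots> = f U * real \<kappa>" using fU \<kappa>0 by simp
        finally have "(real D * \<delta> - f U) * real \<kappa> \<le> \<delta> * Ce" by (simp add: algebra_simps)
        also have "\<dots> < \<eta> * real \<kappa>" using \<kappa>\<eta> \<eta> \<open>\<delta> \<ge> 0\<close> by (simp add: field_simps)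
        finally have "f ud < f U" using \<kappa>0 by (simp add: \<eta>_def)
        then have "U < ud" using f_anti[of ud U] U by force
        then have "\<epsilon> \<le> poly p U" using x(2)[of U] U by (auto simp: \<epsilon>_def)
        then have "b J > 0" unfolding U_def by (rule b_pos)
        then show ?thesis using w by (simp add: J_def)
      qed
      ultimately have "(\<Sum>m\<le>K. coeff w m * b (K - m)) > 0" by (intro sum_pos2[of _ 0]) auto
      then show False using sum0 by simp
    qed
  qed
qed

end

context divisible_invariants
begin

text \<open>Each length is served by some e < M, so the maximum of finitely many thresholds from
  \<open>no_large_gap\<close> works. The nonzero coefficient found there bounds d i.\<close>

lemma limsup_le:
  fixes n d :: "nat \<Rightarrow> nat" and w :: "nat \<Rightarrow> real poly" and M :: nat
  assumes n: "filterlim n at_top sequentially"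
    and degree_eq: "\<And>i. \<exists>e<M. \<exists>K. D * Suc (c * K) = n i + 2 + dA + c * D + e * dE"
    and deg: "\<And>i. c * degree (w i) \<le> n i"
    and nonneg: "\<And>i m. coeff (w i) m \<ge> 0" and pos: "\<And>i. coeff (w i) 0 > 0"
    and inv: "\<And>i s. 1 + (q - 1) * s \<noteq> 0 \<Longrightarrow>
      poly (w i) (((1 - s) / (1 + (q - 1) * s)) ^ c) * (1 + (q - 1) * s) ^ n i = sqrt q ^ n i * poly (w i) (s ^ c)"
    and d: "\<And>i m. m > 0 \<Longrightarrow> coeff (w i) m \<noteq> 0 \<Longrightarrow> d i \<le> c * m"
  shows "limsup (\<lambda>i. ereal (real (d i) / real (n i)))
    \<le> ereal ((q - 1) / q * (1 - (real c + 1) powr (- (1 / real c))))"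
proof (rule ereal_le_epsilon2)
  fix \<eta> :: real assume \<eta>: "0 < \<eta>"
  define \<delta> where "\<delta> = (q - 1) / q * (1 - y0) + \<eta>"
  have "\<forall>e. \<exists>n0. \<forall>n\<ge>n0. \<forall>K w. D * Suc (c * K) = n + 2 + dA + c * D + e * dE \<longrightarrow>
     c * degree w \<le> n \<longrightarrow> (\<forall>m. coeff w m \<ge> 0) \<longrightarrow> coeff w 0 > 0 \<longrightarrow>
     (\<forall>s. 1 + (q - 1) * s \<noteq> 0 \<longrightarrow> poly w (sg s ^ c) * (1 + (q - 1) * s) ^ n = sqrt q ^ n * poly w (s ^ c)) \<longrightarrow>
     (\<exists>m>0. real (c * m) < \<delta> * real n \<and> coeff w m \<noteq> 0)"
    using no_large_gap[of \<delta>] \<eta> unfolding \<delta>_def by simp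
  then obtain n0 where n0: "\<And>e n K w. n \<ge> n0 e \<Longrightarrow> D * Suc (c * K) = n + 2 + dA + c * D + e * dE \<Longrightarrow>
     c * degree w \<le> n \<Longrightarrow> (\<forall>m. coeff w m \<ge> 0) \<Longrightarrow> coeff w 0 > 0 \<Longrightarrow>
     (\<forall>s. 1 + (q - 1) * s \<noteq> 0 \<longrightarrow> poly w (sg s ^ c) * (1 + (q - 1) * s) ^ n = sqrt q ^ n * poly w (s ^ c)) \<Longrightarrow>
     \<exists>m>0. real (c * m) < \<delta> * real n \<and> coeff w m \<noteq> 0"
    by metis
  have "eventually (\<lambda>i. \<forall>e\<in>{..<M}. n0 e \<le> n i) sequentially"
    using n by (intro eventually_ball_finite) (auto simp: filterlim_at_top)
  moreover have "eventually (\<lambda>i. 1 \<le> n i) sequentially"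
    using n by (simp add: filterlim_at_top)
  ultimately have "eventually (\<lambda>i. ereal (real (d i) / real (n i)) \<le> ereal \<delta>) sequentially"
  proof eventually_elim
    case (elim i)
    obtain e K where e: "e < M" and K: "D * Suc (c * K) = n i + 2 + dA + c * D + e * dE"
      using degree_eq by blast
    obtain m where m: "m > 0" "real (c * m) < \<delta> * real (n i)" "coeff (w i) m \<noteq> 0"
      using n0[OF _ K deg] elim(1) e nonneg pos inv unfolding sg_def by blast
    have "real (d i) \<le> \<delta> * real (n i)" using d[OF m(1,3)] m(2) by (simp add: of_nat_mono[THEN order_trans])
    then show ?case using elim(2) by (simp add: divide_le_eq)
  qed
  then have "limsup (\<lambda>i. ereal (real (d i) / real (n i))) \<le> ereal \<delta>"
    by (rule Limsup_bounded)
  then show "limsup (\<lambda>i. ereal (real (d i) / real (n i)))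
      \<le> ereal ((q - 1) / q * (1 - (real c + 1) powr (- (1 / real c)))) + ereal \<eta>"
    by (simp add: \<delta>_def y0_def)
qed

end

section \<open>The invariants in the five cases\<close>

text \<open>x + (sqrt q - 1) y and x - (sqrt q + 1) y are the eigenvectors of the MacWilliams
  substitution, with eigenvalues sqrt q and -sqrt q; here x = 1.\<close>

lemma invariants_1:
  fixes q :: real
  assumes q: "q > 1"
  shows "divisible_invariants q 1 2 1 1 2 [:1, - (sqrt q + 1):] [:1, sqrt q - 1:]"
proof
  have sq: "sqrt q * sqrt q = q" using q by simp
  have sq1: "sqrt q > 1" using q by simp
  show "q > 1" by fact
  show "(1 - s) * ((1 + (q - 1) * s) ^ 1 - (1 - s) ^ 1) * (1 + (q - 1) * s) ^ (2 - Suc 1) = sqrt q ^ 2 * (s * (1 - s ^ 1))" for s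
    using q by (simp add: algebra_simps)
  show "poly [:1, sqrt q - 1:] (((1 - s) / (1 + (q - 1) * s)) ^ 1) * (1 + (q - 1) * s) ^ 1 = sqrt q ^ 1 * poly [:1, sqrt q - 1:] (s ^ 1)"
    if nz: "1 + (q - 1) * s \<noteq> 0" for s
  proof -
    have "poly [:1, sqrt q - 1:] (((1 - s) / (1 + (q - 1) * s)) ^ 1) * (1 + (q - 1) * s) ^ 1 = (1 + (q - 1) * s) + (sqrt q - 1) * (1 - s)"
      using nz by (simp add: distrib_right)
    also have "\<dots> = sqrt q * (1 + (sqrt q - 1) * s)" using sq by (simp add: algebra_simps)
    finally show ?thesis by (simp add: mult.commute)
  qed
  show "poly [:1, - (sqrt q + 1):] (((1 - s) / (1 + (q - 1) * s)) ^ 1) * (1 + (q - 1) * s) ^ 1 = - (sqrt q ^ 1 * poly [:1, - (sqrt q + 1):] (s ^ 1))"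
    if nz: "1 + (q - 1) * s \<noteq> 0" for s
  proof -
    have "poly [:1, - (sqrt q + 1):] (((1 - s) / (1 + (q - 1) * s)) ^ 1) * (1 + (q - 1) * s) ^ 1 = (1 + (q - 1) * s) + (- (sqrt q + 1)) * (1 - s)"
      using nz by (simp only: poly_pCons poly_0 power_one_right mult_zero_right add_0_right) (simp add: distrib_right)
    also have "\<dots> = - (sqrt q * (1 + (- (sqrt q + 1)) * s))" using sq by (simp add: algebra_simps)
    finally show ?thesis by (simp add: mult.commute)
  qed
  show "poly [:1, sqrt q - 1:] u > 0" if "u \<ge> 0" for u
    using that sq1 by (simp add: add_pos_nonneg)
  show "poly [:1, - (sqrt q + 1):] v \<le> poly [:1, - (sqrt q + 1):] u" if "u \<le> v" for u v
    using mult_left_mono[OF that, of "sqrt q + 1"] sq1 by (simp add: algebra_simps)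
  show "poly [:1, - (sqrt q + 1):] (1 / (real 1 + 1)) < 0"
  proof -
    have "1 + (- a - 1) / 2 < 0" if "1 < a" for a :: real using that by (simp add: field_simps)
    from this[OF sq1] show ?thesis by simp
  qed
  show "(1 - (real 1 + 1) * u) * poly [:1, sqrt q - 1:] u - real 2 * u * (1 - u) * poly (pderiv [:1, sqrt q - 1:]) u = poly [:1, - (sqrt q + 1):] u" for u
    by (simp add: pderiv_pCons algebra_simps)
qed auto

text \<open>E is x^2 + y^2, the enumerator of the binary repetition code of length 2, and B stands
  for x^2 y^2 (x^2 - y^2)^2.\<close>

lemma invariants_2_2: "divisible_invariants 2 2 4 4 2 4 [:1, -6, 1:] [:1, 1:]"
proof
  have s4: "sqrt 2 ^ 4 = (4::real)" and s2: "sqrt 2 ^ 2 = (2::real)"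
    by (simp_all add: power4_eq_xxxx)
  show "(1 - s) * ((1 + (2 - 1) * s) ^ 2 - (1 - s) ^ 2) * (1 + (2 - 1) * s) ^ (4 - Suc 2) = sqrt 2 ^ 4 * (s * (1 - s ^ 2))" for s :: real
    unfolding s4 by (simp add: power2_eq_square algebra_simps)
  show "poly [:1, 1:] (((1 - s) / (1 + (2 - 1) * s)) ^ 2) * (1 + (2 - 1) * s) ^ 2 = sqrt 2 ^ 2 * poly [:1, 1:] (s ^ 2)"
    if nz: "1 + (2 - 1) * s \<noteq> 0" for s :: real
  proof -
    have T: "1 + (2 - 1) * s = 1 + s" by simp
    have P: "poly [:1, 1:] u = 1 + u" for u :: real by (simp add: algebra_simps power2_eq_square power3_eq_cube)
    have "(1 + (x / y) ^ 2) * y ^ 2 = y ^ 2 + x ^ 2" if "y \<noteq> 0" for x y :: real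
      using that by (simp add: field_simps eval_nat_numeral)
    from this[of "1 + s" "1 - s"] have "poly [:1, 1:] (((1 - s) / (1 + s)) ^ 2) * (1 + s) ^ 2 = (1 + s) ^ 2 + (1 - s) ^ 2"
      unfolding P using nz by simp
    also have "\<dots> = 2 * (1 + (s ^ 2))" by algebra
    finally show ?thesis unfolding T P s2 .
  qed
  show "poly [:1, -6, 1:] (((1 - s) / (1 + (2 - 1) * s)) ^ 2) * (1 + (2 - 1) * s) ^ 4 = - (sqrt 2 ^ 4 * poly [:1, -6, 1:] (s ^ 2))"
    if nz: "1 + (2 - 1) * s \<noteq> 0" for s :: real
  proof -
    have T: "1 + (2 - 1) * s = 1 + s" by simp
    have P: "poly [:1, -6, 1:] u = 1 - 6 * u + (u) ^ 2" for u :: real by (simp add: algebra_simps power2_eq_square power3_eq_cube)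
    have "(1 - 6 * (x / y) ^ 2 + ((x / y) ^ 2) ^ 2) * y ^ 4 = y ^ 4 - 6 * x ^ 2 * y ^ 2 + x ^ 4" if "y \<noteq> 0" for x y :: real
      using that by (simp add: field_simps eval_nat_numeral)
    from this[of "1 + s" "1 - s"] have "poly [:1, -6, 1:] (((1 - s) / (1 + s)) ^ 2) * (1 + s) ^ 4 = (1 + s) ^ 4 - 6 * (1 - s) ^ 2 * (1 + s) ^ 2 + (1 - s) ^ 4"
      unfolding P using nz by simp
    also have "\<dots> = - (4 * (1 - 6 * (s ^ 2) + ((s ^ 2)) ^ 2))" by algebra
    finally show ?thesis unfolding T P s4 .
  qed
  show "poly [:1, -6, 1:] v \<le> poly [:1, -6, 1:] u" if "0 \<le> u" "u \<le> v" "v \<le> 1" for u v :: real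
  proof -
    have "poly [:1, -6, 1:] u - poly [:1, -6, 1:] v = (v - u) * (6 - (u + v))" by (simp add: algebra_simps)
    also have "\<dots> \<ge> 0" using that by (intro mult_nonneg_nonneg) auto
    finally show ?thesis by simp
  qed
qed (auto simp: pderiv_pCons algebra_simps)

text \<open>E is x^8 + 14 x^4 y^4 + y^8, the enumerator of the extended Hamming code, B stands for
  x^4 y^4 (x^4 - y^4)^4, and A has weight 12.\<close>

lemma invariants_2_4: "divisible_invariants 2 4 6 12 8 3 [:1, -33, -33, 1:] [:1, 14, 1:]"
proof
  have "sqrt 2 ^ (2 * k) = (2::real) ^ k" for k by (simp add: power_mult)
  from this[of 3] this[of 4] this[of 6]
  have s6: "sqrt 2 ^ 6 = (8::real)" and s8: "sqrt 2 ^ 8 = (16::real)" and s12: "sqrt 2 ^ 12 = (64::real)" by simp_all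
  show "(1 - s) * ((1 + (2 - 1) * s) ^ 4 - (1 - s) ^ 4) * (1 + (2 - 1) * s) ^ (6 - Suc 4) = sqrt 2 ^ 6 * (s * (1 - s ^ 4))" for s :: real
    unfolding s6 by (simp add: eval_nat_numeral algebra_simps)
  show "poly [:1, 14, 1:] (((1 - s) / (1 + (2 - 1) * s)) ^ 4) * (1 + (2 - 1) * s) ^ 8 = sqrt 2 ^ 8 * poly [:1, 14, 1:] (s ^ 4)"
    if nz: "1 + (2 - 1) * s \<noteq> 0" for s :: real
  proof -
    have T: "1 + (2 - 1) * s = 1 + s" by simp
    have P: "poly [:1, 14, 1:] u = 1 + 14 * u + (u) ^ 2" for u :: real by (simp add: algebra_simps power2_eq_square power3_eq_cube)
    have "(1 + 14 * (x / y) ^ 4 + ((x / y) ^ 4) ^ 2) * y ^ 8 = y ^ 8 + 14 * x ^ 4 * y ^ 4 + x ^ 8" if "y \<noteq> 0" for x y :: real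
      using that by (simp add: field_simps eval_nat_numeral)
    from this[of "1 + s" "1 - s"] have "poly [:1, 14, 1:] (((1 - s) / (1 + s)) ^ 4) * (1 + s) ^ 8 = (1 + s) ^ 8 + 14 * (1 - s) ^ 4 * (1 + s) ^ 4 + (1 - s) ^ 8"
      unfolding P using nz by simp
    also have "\<dots> = 16 * (1 + 14 * (s ^ 4) + ((s ^ 4)) ^ 2)" by algebra
    finally show ?thesis unfolding T P s8 .
  qed
  show "poly [:1, -33, -33, 1:] (((1 - s) / (1 + (2 - 1) * s)) ^ 4) * (1 + (2 - 1) * s) ^ 12 = - (sqrt 2 ^ 12 * poly [:1, -33, -33, 1:] (s ^ 4))"
    if nz: "1 + (2 - 1) * s \<noteq> 0" for s :: real
  proof -
    have T: "1 + (2 - 1) * s = 1 + s" by simp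
    have P: "poly [:1, -33, -33, 1:] u = 1 - 33 * u - 33 * (u) ^ 2 + (u) ^ 3" for u :: real by (simp add: algebra_simps power2_eq_square power3_eq_cube)
    have "(1 - 33 * (x / y) ^ 4 - 33 * ((x / y) ^ 4) ^ 2 + ((x / y) ^ 4) ^ 3) * y ^ 12 = y ^ 12 - 33 * x ^ 4 * y ^ 8 - 33 * x ^ 8 * y ^ 4 + x ^ 12" if "y \<noteq> 0" for x y :: real
      using that by (simp add: field_simps eval_nat_numeral)
    from this[of "1 + s" "1 - s"] have "poly [:1, -33, -33, 1:] (((1 - s) / (1 + s)) ^ 4) * (1 + s) ^ 12 = (1 + s) ^ 12 - 33 * (1 - s) ^ 4 * (1 + s) ^ 8 - 33 * (1 - s) ^ 8 * (1 + s) ^ 4 + (1 - s) ^ 12"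
      unfolding P using nz by simp
    also have "\<dots> = - (64 * (1 - 33 * (s ^ 4) - 33 * ((s ^ 4)) ^ 2 + ((s ^ 4)) ^ 3))" by algebra
    finally show ?thesis unfolding T P s12 .
  qed
  show "poly [:1, -33, -33, 1:] v \<le> poly [:1, -33, -33, 1:] u" if "0 \<le> u" "u \<le> v" "v \<le> 1" for u v :: real
  proof -
    have "u * u \<le> 1" "u * v \<le> 1" "v * v \<le> 1" using that by (auto intro!: mult_le_one)
    then have "(v - u) * (33 + 33 * (u + v) - (u * u + u * v + v * v)) \<ge> 0"
      using that by (intro mult_nonneg_nonneg) auto
    also have "(v - u) * (33 + 33 * (u + v) - (u * u + u * v + v * v))
       = poly [:1, -33, -33, 1:] u - poly [:1, -33, -33, 1:] v" by (simp add: algebra_simps)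
    finally show ?thesis by simp
  qed
qed (auto simp: pderiv_pCons algebra_simps add_pos_nonneg)

text \<open>E is x^4 + 8 x y^3, the enumerator of the tetracode; the factor x is visible only in the
  weight \<open>dE\<close>.\<close>

lemma invariants_3_3: "divisible_invariants 3 3 4 6 4 3 [:1, -20, -8:] [:1, 8:]"
proof
  have "sqrt 3 ^ (2 * k) = (3::real) ^ k" for k by (simp add: power_mult)
  from this[of 2] this[of 3]
  have s4: "sqrt 3 ^ 4 = (9::real)" and s6: "sqrt 3 ^ 6 = (27::real)" by simp_all
  show "(1 - s) * ((1 + (3 - 1) * s) ^ 3 - (1 - s) ^ 3) * (1 + (3 - 1) * s) ^ (4 - Suc 3) = sqrt 3 ^ 4 * (s * (1 - s ^ 3))" for s :: real
    unfolding s4 by (simp add: eval_nat_numeral algebra_simps)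
  show "poly [:1, 8:] (((1 - s) / (1 + (3 - 1) * s)) ^ 3) * (1 + (3 - 1) * s) ^ 4 = sqrt 3 ^ 4 * poly [:1, 8:] (s ^ 3)"
    if nz: "1 + (3 - 1) * s \<noteq> 0" for s :: real
  proof -
    have T: "1 + (3 - 1) * s = 1 + 2 * s" by simp
    have P: "poly [:1, 8:] u = 1 + 8 * u" for u :: real by (simp add: algebra_simps power2_eq_square power3_eq_cube)
    have "(1 + 8 * (x / y) ^ 3) * y ^ 4 = y ^ 4 + 8 * x ^ 3 * y" if "y \<noteq> 0" for x y :: real
      using that by (simp add: field_simps eval_nat_numeral)
    from this[of "1 + 2 * s" "1 - s"] have "poly [:1, 8:] (((1 - s) / (1 + 2 * s)) ^ 3) * (1 + 2 * s) ^ 4 = (1 + 2 * s) ^ 4 + 8 * (1 - s) ^ 3 * (1 + 2 * s)"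
      unfolding P using nz by simp
    also have "\<dots> = 9 * (1 + 8 * (s ^ 3))" by algebra
    finally show ?thesis unfolding T P s4 .
  qed
  show "poly [:1, -20, -8:] (((1 - s) / (1 + (3 - 1) * s)) ^ 3) * (1 + (3 - 1) * s) ^ 6 = - (sqrt 3 ^ 6 * poly [:1, -20, -8:] (s ^ 3))"
    if nz: "1 + (3 - 1) * s \<noteq> 0" for s :: real
  proof -
    have T: "1 + (3 - 1) * s = 1 + 2 * s" by simp
    have P: "poly [:1, -20, -8:] u = 1 - 20 * u - 8 * (u) ^ 2" for u :: real by (simp add: algebra_simps power2_eq_square power3_eq_cube)
    have "(1 - 20 * (x / y) ^ 3 - 8 * ((x / y) ^ 3) ^ 2) * y ^ 6 = y ^ 6 - 20 * x ^ 3 * y ^ 3 - 8 * x ^ 6" if "y \<noteq> 0" for x y :: real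
      using that by (simp add: field_simps eval_nat_numeral)
    from this[of "1 + 2 * s" "1 - s"] have "poly [:1, -20, -8:] (((1 - s) / (1 + 2 * s)) ^ 3) * (1 + 2 * s) ^ 6 = (1 + 2 * s) ^ 6 - 20 * (1 - s) ^ 3 * (1 + 2 * s) ^ 3 - 8 * (1 - s) ^ 6"
      unfolding P using nz by simp
    also have "\<dots> = - (27 * (1 - 20 * (s ^ 3) - 8 * ((s ^ 3)) ^ 2))" by algebra
    finally show ?thesis unfolding T P s6 .
  qed
  show "poly [:1, -20, -8:] v \<le> poly [:1, -20, -8:] u" if "0 \<le> u" "u \<le> v" "v \<le> 1" for u v :: real
  proof -
    have "poly [:1, -20, -8:] u - poly [:1, -20, -8:] v = (v - u) * (20 + 8 * (u + v))" by (simp add: algebra_simps)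
    also have "\<dots> \<ge> 0" using that by (intro mult_nonneg_nonneg) auto
    finally show ?thesis by simp
  qed
qed (auto simp: pderiv_pCons algebra_simps)

text \<open>E is x^2 + 3 y^2, the enumerator of the repetition code of length 2, and A is x (x^2 - 9
  y^2).\<close>

lemma invariants_4_2: "divisible_invariants 4 2 3 3 2 3 [:1, -9:] [:1, 3:]"
proof
  have s2: "sqrt 4 ^ 2 = (4::real)" and s3: "sqrt 4 ^ 3 = (8::real)" by simp_all
  show "(1 - s) * ((1 + (4 - 1) * s) ^ 2 - (1 - s) ^ 2) * (1 + (4 - 1) * s) ^ (3 - Suc 2) = sqrt 4 ^ 3 * (s * (1 - s ^ 2))" for s :: real
    by (simp add: eval_nat_numeral algebra_simps)
  show "poly [:1, 3:] (((1 - s) / (1 + (4 - 1) * s)) ^ 2) * (1 + (4 - 1) * s) ^ 2 = sqrt 4 ^ 2 * poly [:1, 3:] (s ^ 2)"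
    if nz: "1 + (4 - 1) * s \<noteq> 0" for s :: real
  proof -
    have T: "1 + (4 - 1) * s = 1 + 3 * s" by simp
    have P: "poly [:1, 3:] u = 1 + 3 * u" for u :: real by (simp add: algebra_simps power2_eq_square power3_eq_cube)
    have "(1 + 3 * (x / y) ^ 2) * y ^ 2 = y ^ 2 + 3 * x ^ 2" if "y \<noteq> 0" for x y :: real
      using that by (simp add: field_simps eval_nat_numeral)
    from this[of "1 + 3 * s" "1 - s"] have "poly [:1, 3:] (((1 - s) / (1 + 3 * s)) ^ 2) * (1 + 3 * s) ^ 2 = (1 + 3 * s) ^ 2 + 3 * (1 - s) ^ 2"
      unfolding P using nz by simp
    also have "\<dots> = 4 * (1 + 3 * (s ^ 2))" by algebra
    finally show ?thesis unfolding T P s2 .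
  qed
  show "poly [:1, -9:] (((1 - s) / (1 + (4 - 1) * s)) ^ 2) * (1 + (4 - 1) * s) ^ 3 = - (sqrt 4 ^ 3 * poly [:1, -9:] (s ^ 2))"
    if nz: "1 + (4 - 1) * s \<noteq> 0" for s :: real
  proof -
    have T: "1 + (4 - 1) * s = 1 + 3 * s" by simp
    have P: "poly [:1, -9:] u = 1 - 9 * u" for u :: real by (simp add: algebra_simps power2_eq_square power3_eq_cube)
    have "(1 - 9 * (x / y) ^ 2) * y ^ 3 = y ^ 3 - 9 * x ^ 2 * y" if "y \<noteq> 0" for x y :: real
      using that by (simp add: field_simps eval_nat_numeral)
    from this[of "1 + 3 * s" "1 - s"] have "poly [:1, -9:] (((1 - s) / (1 + 3 * s)) ^ 2) * (1 + 3 * s) ^ 3 = (1 + 3 * s) ^ 3 - 9 * (1 - s) ^ 2 * (1 + 3 * s)"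
      unfolding P using nz by simp
    also have "\<dots> = - (8 * (1 - 9 * (s ^ 2)))" by algebra
    finally show ?thesis unfolding T P s3 .
  qed
qed (auto simp: pderiv_pCons algebra_simps)

section \<open>Divisible formally self-dual codes\<close>

lemma hamming_weight_le: "hamming_weight z v \<le> length v"
proof -
  have "hamming_weight z v \<le> card {i. i < length v}"
    unfolding hamming_weight_def by (rule card_mono) auto
  then show ?thesis by simp
qed

lemma hamming_weight_eq_0:
  assumes "hamming_weight z v = 0" "i < length v"
  shows "v ! i = z"
  using assms by (auto simp: hamming_weight_def)

locale divisible_self_dual_code =
  fixes A :: "'a set" and z :: 'a and q c n :: nat and C :: "'a list set"
  assumes card_A: "card A = q" and q: "q > 1" and c: "c > 0"
    and fsd: "formally_self_dual A z n C"
    and dvd: "\<And>w. w \<in> C \<Longrightarrow> c dvd hamming_weight z w"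
begin

abbreviation wt :: "'a list \<Rightarrow> nat" where "wt \<equiv> hamming_weight z"

definition W :: "real poly" where "W = (\<Sum>v\<in>C. monom 1 (wt v div c))"

lemma length_code: "v \<in> C \<Longrightarrow> length v = n"
  using fsd by (auto simp: formally_self_dual_def words_def)

lemma finite_code: "finite C"
proof -
  have "finite A" using card_A q by (metis card.infinite not_less_zero)
  then have "finite {w. set w \<subseteq> A \<and> length w = n}" by (rule finite_lists_length_eq)
  then show ?thesis using fsd by (auto simp: formally_self_dual_def words_def intro: finite_subset)
qed

lemma wt_le: "v \<in> C \<Longrightarrow> wt v \<le> n"
  using hamming_weight_le[of z v] length_code by simp

lemma powr_eq_sqrt_power: "real q powr (- (real n / 2)) = 1 / sqrt (real q) ^ n"
proof -
  have "real q powr (real n / 2) = (real q powr (1 / 2)) powr real n" by (simp add: powr_powr)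
  also have "\<dots> = sqrt (real q) ^ n" using q by (simp add: powr_half_sqrt powr_realpow)
  finally show ?thesis by (simp add: powr_minus_divide)
qed

lemma card_code: "real (card C) = sqrt (real q) ^ n"
  using fsd powr_eq_sqrt_power card_A by (simp add: formally_self_dual_def powr_minus_divide)

lemma card_code_pos: "card C > 0"
proof -
  have "real (card C) > 0" unfolding card_code using q by simp
  then show ?thesis by simp
qed

lemma macwilliams:
  "sqrt (real q) ^ n * (\<Sum>v\<in>C. x ^ (n - wt v) * y ^ wt v)
     = (\<Sum>v\<in>C. (x + (real q - 1) * y) ^ (n - wt v) * (x - y) ^ wt v)"
proof -
  have "weight_enumerator z n C x y = 1 / sqrt (real q) ^ n * weight_enumerator z n C (x + (real q - 1) * y) (x - y)"
    using fsd card_A unfolding formally_self_dual_def powr_eq_sqrt_power[symmetric] by blast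
  moreover have "sqrt (real q) ^ n \<noteq> 0" using q by simp
  ultimately have "sqrt (real q) ^ n * weight_enumerator z n C x y = weight_enumerator z n C (x + (real q - 1) * y) (x - y)"
    by (simp add: field_simps)
  then show ?thesis by (simp only: weight_enumerator_def)
qed

lemma poly_W: "poly W (s ^ c) = (\<Sum>v\<in>C. s ^ wt v)"
  unfolding W_def poly_sum poly_monom
  by (rule sum.cong) (use dvd in \<open>auto simp: power_mult[symmetric]\<close>)

lemma W_inv:
  assumes "1 + (real q - 1) * s \<noteq> 0"
  shows "poly W (((1 - s) / (1 + (real q - 1) * s)) ^ c) * (1 + (real q - 1) * s) ^ n = sqrt (real q) ^ n * poly W (s ^ c)"
proof -
  let ?T = "1 + (real q - 1) * s"
  have "poly W (((1 - s) / ?T) ^ c) * ?T ^ n = (\<Sum>v\<in>C. ?T ^ (n - wt v) * (1 - s) ^ wt v)"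
    unfolding poly_W sum_distrib_right
  proof (rule sum.cong)
    fix v assume "v \<in> C"
    then have "?T ^ n = ?T ^ wt v * ?T ^ (n - wt v)" using wt_le by (simp add: power_add[symmetric])
    then show "((1 - s) / ?T) ^ wt v * ?T ^ n = ?T ^ (n - wt v) * (1 - s) ^ wt v"
      using assms by (simp add: power_divide)
  qed simp
  also have "\<dots> = sqrt (real q) ^ n * poly W (s ^ c)"
    using macwilliams[of 1 s] by (simp add: poly_W)
  finally show ?thesis .
qed

lemma degree_W: "c * degree W \<le> n"
proof -
  have "degree W \<le> n div c"
    unfolding W_def
    by (rule degree_sum_le[OF finite_code]) (metis degree_monom_le div_le_mono le_trans wt_le)
  then have "c * degree W \<le> c * (n div c)" by simp
  then show ?thesis using times_div_less_eq_dividend le_trans by blast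
qed

lemma coeff_W: "coeff W m = real (card {v \<in> C. wt v = c * m})"
proof -
  have "coeff W m = (\<Sum>v\<in>C. if wt v = c * m then 1 else 0)"
    unfolding W_def coeff_sum by (rule sum.cong) (use dvd c in auto)
  also have "\<dots> = real (card {v \<in> C. wt v = c * m})"
    using finite_code by (simp add: sum.If_cases Collect_conj_eq Int_commute)
  finally show ?thesis .
qed

text \<open>Codes need not be linear, so this comes from the MacWilliams identity at (1, 0): one
  side counts the words of weight 0 up to a factor, the other is the size of the code.\<close>

lemma zero_word: "\<exists>v\<in>C. wt v = 0"
proof (rule ccontr)
  assume "\<not> ?thesis"
  then have "(\<Sum>v\<in>C. 1 ^ (n - wt v) * 0 ^ wt v) = (0::real)" by (intro sum.neutral) auto
  then have "(\<Sum>v\<in>C. (1::real)) = 0" using macwilliams[of 1 0] by simp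
  then show False using card_code_pos by simp
qed

lemma coeff_W_0_pos: "coeff W 0 > 0"
  using zero_word finite_code by (auto simp: coeff_W card_gt_0_iff)

text \<open>The distance from a word to the all-z word is its weight, so any nonzero weight bounds
  the minimum distance without linearity.\<close>

lemma min_dist_le:
  assumes "m > 0" "coeff W m \<noteq> 0"
  shows "min_dist C \<le> c * m"
proof -
  have "{v \<in> C. wt v = c * m} \<noteq> {}" using assms(2) by (simp add: coeff_W card_eq_0_iff)
  then obtain v where v: "v \<in> C" "wt v = c * m" by blast
  obtain v0 where v0: "v0 \<in> C" "wt v0 = 0" using zero_word by blast
  have "wt v \<noteq> 0" using v assms c by simp
  then have "v \<noteq> v0" using v0 by auto
  have "v0 ! i = z" if "i < length v" for i
    using hamming_weight_eq_0[OF v0(2)] that length_code v(1) v0(1) by simp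
  then have dist: "hamming_dist v v0 = c * m"
    unfolding hamming_dist_def v(2)[symmetric] hamming_weight_def by (intro arg_cong[of _ _ card]) auto
  have "finite {hamming_dist u v | u v. u \<in> C \<and> v \<in> C \<and> u \<noteq> v}"
    by (rule finite_subset[of _ "(\<lambda>(u, v). hamming_dist u v) ` (C \<times> C)"]) (auto simp: finite_code)
  moreover have "hamming_dist v v0 \<in> {hamming_dist u v | u v. u \<in> C \<and> v \<in> C \<and> u \<noteq> v}"
    using v(1) v0(1) \<open>v \<noteq> v0\<close> by blast
  ultimately show ?thesis
    unfolding min_dist_def dist by (rule Min_le)
qed

section \<open>Divisibility of the length\<close>

text \<open>The difference of the two sides is a polynomial with infinitely many real zeros, so the
  identity extends to complex roots of unity.\<close>

lemma macwilliams_complex: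
  fixes y :: complex
  shows "of_real (sqrt (real q)) ^ n * (\<Sum>v\<in>C. y ^ wt v)
     = (\<Sum>v\<in>C. (1 + (of_nat q - 1) * y) ^ (n - wt v) * (1 - y) ^ wt v)"
proof -
  define P where "P = smult (complex_of_real (sqrt (real q)) ^ n) (\<Sum>v\<in>C. monom 1 (wt v))
    - (\<Sum>v\<in>C. [:1, of_nat q - 1:] ^ (n - wt v) * [:1, -1:] ^ wt v)"
  have P: "poly P x = of_real (sqrt (real q)) ^ n * (\<Sum>v\<in>C. x ^ wt v)
     - (\<Sum>v\<in>C. (1 + (of_nat q - 1) * x) ^ (n - wt v) * (1 - x) ^ wt v)" for x
    by (simp add: P_def poly_sum poly_monom mult.commute[of x])
  have "P = 0"
  proof (rule ccontr)
    assume "P \<noteq> 0"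
    then have "finite {x. poly P x = 0}" by (rule poly_roots_finite)
    moreover have "of_real ` UNIV \<subseteq> {x. poly P x = 0}"
    proof clarify
      fix x :: real
      show "poly P (of_real x) = 0"
        unfolding P using arg_cong[OF macwilliams[of 1 x], of complex_of_real] by simp
    qed
    ultimately have "finite (range complex_of_real)" by (rule rev_finite_subset)
    then show False
      by (simp add: finite_image_iff inj_on_def infinite_UNIV_char_0)
  qed
  then show ?thesis using P[of y] by simp
qed

text \<open>Evaluating the MacWilliams identity at $y = \zeta$ gives the divisibility conditions on $n$.\<close>

lemma unit_root_power:
  fixes \<zeta> :: complex
  assumes root: "\<zeta> ^ c = 1" and eq: "(1 - \<zeta>) ^ c = (1 + (of_nat q - 1) * \<zeta>) ^ c"
  shows "(1 + (of_nat q - 1) * \<zeta>) ^ n = of_real (sqrt (real q)) ^ n"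
proof -
  let ?T = "1 + (of_nat q - 1) * \<zeta>"
  have "\<zeta> ^ wt v = 1" if "v \<in> C" for v
    using dvd[OF that] root by (auto simp: power_mult)
  moreover have "?T ^ (n - wt v) * (1 - \<zeta>) ^ wt v = ?T ^ n" if v: "v \<in> C" for v
  proof -
    have "(1 - \<zeta>) ^ wt v = ?T ^ wt v" using dvd[OF v] eq by (auto simp: power_mult)
    then show ?thesis using wt_le[OF v] by (simp add: power_add[symmetric])
  qed
  ultimately have "of_real (sqrt (real q)) ^ n * (\<Sum>v\<in>C. 1) = (\<Sum>v\<in>C. ?T ^ n)"
    using macwilliams_complex[of \<zeta>] by (simp cong: sum.cong)
  then show ?thesis using card_code_pos by simp
qed

text \<open>At \<zeta> = -1 the factor 1 + (q - 1) \<zeta> is 0, so \<open>unit_root_power\<close>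
  does not apply. Instead, for odd n no word has weight n and the transformed enumerator vanishes at
  (1, -1), while the original one there is the size of the code.\<close>

lemma length_dvd_2_2:
  assumes "q = 2" "c = 2"
  shows "2 dvd n"
proof (rule ccontr)
  assume odd: "\<not> 2 dvd n"
  have "0 ^ (n - wt v) * 2 ^ wt v = (0::real)" if v: "v \<in> C" for v
  proof -
    have "n \<noteq> wt v" using dvd[OF v] odd assms by auto
    then show ?thesis using wt_le[OF v] by simp
  qed
  then have "(\<Sum>v\<in>C. 0 ^ (n - wt v) * 2 ^ wt v) = (0::real)" by (rule sum.neutral[OF ballI])
  then have "sqrt (real q) ^ n * (\<Sum>v\<in>C. (-1) ^ wt v) = 0"
    using macwilliams[of 1 "-1"] assms by simp
  moreover have "(\<Sum>v\<in>C. (-1) ^ wt v) = (\<Sum>v\<in>C. 1 :: real)"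
    using dvd assms by (intro sum.cong) auto
  ultimately show False using card_code_pos q by simp
qed

lemma length_dvd_4_2:
  assumes "q = 4" "c = 2"
  shows "2 dvd n"
proof -
  have "(- 2) ^ n = (2 :: complex) ^ n"
    using unit_root_power[of "-1"] assms by simp
  then show ?thesis by (cases "even n") (auto simp: power_minus[of 2])
qed

text \<open>For a primitive cube root of unity \<omega>, 1 + 2 \<omega> = \<i> sqrt 3, so
  \<open>unit_root_power\<close> reduces to \<i>^n = 1.\<close>

lemma length_dvd_3_3:
  assumes "q = 3" "c = 3"
  shows "4 dvd n"
proof -
  define \<omega> where "\<omega> = Complex (- 1 / 2) (sqrt 3 / 2)"
  have T: "1 + (of_nat q - 1) * \<omega> = \<i> * of_real (sqrt 3)"
    using assms by (simp add: \<omega>_def complex_eq_iff)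
  have s: "sqrt 3 * (sqrt 3 * x) = 3 * x" for x :: real by (simp flip: mult.assoc)
  have "\<omega> ^ c = 1" "(1 - \<omega>) ^ c = (\<i> * of_real (sqrt 3)) ^ c"
    using assms by (simp_all add: \<omega>_def complex_eq_iff eval_nat_numeral field_simps s)
  from unit_root_power[OF this(1)] this(2) T
  have "\<i> ^ n = (1::complex)" using assms by (simp add: power_mult_distrib)
  moreover define b where "b = n mod 4"
  have n: "n = 4 * (n div 4) + b" by (simp add: b_def)
  have "\<i> ^ 4 = 1" by (simp add: eval_nat_numeral)
  then have "\<i> ^ (4 * (n div 4) + b) = \<i> ^ b"
    by (simp only: power_mult power_add power_one mult_1)
  ultimately have "\<i> ^ b = 1" using n by simp
  moreover have "b < 4" by (simp add: b_def)
  then have "b \<in> {0, 1, 2, 3}" by auto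
  ultimately have "b = 0" by (auto simp: eval_nat_numeral complex_eq_iff)
  then show ?thesis by (simp add: b_def dvd_eq_mod_eq_0)
qed

text \<open>With \<zeta> = \<i> the condition reads (1 + \<i>)^n = (sqrt 2)^n, and (1 + \<i>)/sqrt 2
  is a primitive eighth root of unity.\<close>

lemma length_dvd_2_4:
  assumes "q = 2" "c = 4"
  shows "8 dvd n"
proof -
  have eq: "(1 + \<i>) ^ n = of_real (sqrt 2) ^ n"
    using unit_root_power[of \<i>] assms by (simp add: eval_nat_numeral algebra_simps)
  define b where "b = n mod 8"
  have n: "n = 8 * (n div 8) + b" by (simp add: b_def)
  have e8: "(1 + \<i>) ^ 8 = 16" by (simp add: eval_nat_numeral algebra_simps)
  have e8': "complex_of_real (sqrt 2) ^ 8 = 16"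
  proof -
    have "sqrt 2 ^ 8 = (16::real)" using real_sqrt_power_even[of 8 2] by simp
    then show ?thesis by (metis of_real_power of_real_numeral)
  qed
  have "(1 + \<i>) ^ b = of_real (sqrt 2) ^ b"
  proof -
    have "16 ^ (n div 8) * (1 + \<i>) ^ b = 16 ^ (n div 8) * complex_of_real (sqrt 2) ^ b"
      using eq by (subst (asm) (1 2) n) (simp only: power_add power_mult e8 e8')
    then show ?thesis by simp
  qed
  then have b: "(1 + \<i>) ^ b = of_real (sqrt 2 ^ b)" by simp
  have "Im ((1 + \<i>) ^ b) = 0" "Re ((1 + \<i>) ^ b) > 0" unfolding b by simp_all
  moreover have "b < 8" by (simp add: b_def)
  then have "b \<in> {0, 1, 2, 3, 4, 5, 6, 7}" by auto
  ultimately have "b = 0" by (auto simp: eval_nat_numeral)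
  then show ?thesis by (simp add: b_def dvd_eq_mod_eq_0)
qed

end

theorem theorem2:
  fixes q c :: nat
    and A :: "'a set" and z :: 'a
    and n :: "nat \<Rightarrow> nat" and C :: "nat \<Rightarrow> 'a list set"
  assumes "q > 1"
    and "c = 1 \<or> (q, c) \<in> {(2, 2), (2, 4), (3, 3), (4, 2)}"
    and "card A = q" and "z \<in> A"
    and "\<And>i. formally_self_dual A z (n i) (C i)"
    and "\<And>i w. w \<in> C i \<Longrightarrow> c dvd hamming_weight z w"
    and "filterlim n at_top sequentially"
  shows "limsup (\<lambda>i. ereal (real (min_dist (C i)) / real (n i)))
         \<le> ereal ((real q - 1) / real q * (1 - (real c + 1) powr (- (1 / real c))))"
proof -
  have code: "divisible_self_dual_code A z q c (n i) (C i)" for i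
    using assms by unfold_locales auto
  \<comment> \<open>Raising e by r adds c D = dE r to the right-hand side, which raises K by one, so
    the exponents e < r already cover all residue classes; r \<le> 4 in every case. The length must
    first lie in the right class modulo \<open>dE\<close>, which the divisibility lemmas
    ensure.\<close>
  have bound: ?thesis
    if inv: "divisible_invariants (real q) c D dA dE r P E"
      and degree_eq: "\<And>i. \<exists>e<4. \<exists>K. D * Suc (c * K) = n i + 2 + dA + c * D + e * dE"
    for D dA dE r P E
  proof (rule divisible_invariants.limsup_le[OF inv assms(7) degree_eq])
    show "c * degree (divisible_self_dual_code.W z c (C i)) \<le> n i" for i
      by (rule divisible_self_dual_code.degree_W[OF code])
    show "coeff (divisible_self_dual_code.W z c (C i)) m \<ge> 0" for i m
      by (simp add: divisible_self_dual_code.coeff_W[OF code])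
    show "coeff (divisible_self_dual_code.W z c (C i)) 0 > 0" for i
      by (rule divisible_self_dual_code.coeff_W_0_pos[OF code])
  qed (rule divisible_self_dual_code.W_inv[OF code] divisible_self_dual_code.min_dist_le[OF code]; assumption)+
  consider "c = 1" | "q = 2" "c = 2" | "q = 2" "c = 4" | "q = 3" "c = 3" | "q = 4" "c = 2"
    using assms(2) by auto
  then show ?thesis
  proof cases
    case 1
    have "\<exists>e<4. \<exists>K. 2 * Suc (1 * K) = n i + 2 + 1 + 1 * 2 + e * 1" for i by presburger
    with invariants_1[of "real q"] assms(1) 1 show ?thesis by (intro bound) auto
  next
    case 2
    have "\<exists>e<4. \<exists>K. 4 * Suc (2 * K) = n i + 2 + 4 + 2 * 4 + e * 2" for i
      using divisible_self_dual_code.length_dvd_2_2[OF code[of i]] 2 by presburger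
    with invariants_2_2 2 show ?thesis by (intro bound) auto
  next
    case 3
    have "\<exists>e<4. \<exists>K. 6 * Suc (4 * K) = n i + 2 + 12 + 4 * 6 + e * 8" for i
      using divisible_self_dual_code.length_dvd_2_4[OF code[of i]] 3 by presburger
    with invariants_2_4 3 show ?thesis by (intro bound) auto
  next
    case 4
    have "\<exists>e<4. \<exists>K. 4 * Suc (3 * K) = n i + 2 + 6 + 3 * 4 + e * 4" for i
      using divisible_self_dual_code.length_dvd_3_3[OF code[of i]] 4 by presburger
    with invariants_3_3 4 show ?thesis by (intro bound) auto
  next
    case 5
    have "\<exists>e<4. \<exists>K. 3 * Suc (2 * K) = n i + 2 + 3 + 2 * 3 + e * 2" for i
      using divisible_self_dual_code.length_dvd_4_2[OF code[of i]] 5 by presburger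
    with invariants_4_2 5 show ?thesis by (intro bound) auto
  qed
qed

end
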